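(* Let $\mathcal{C}$ and $\mathcal{C}'$ be, respectively, classes of finite $L$- and $L'$-structures, and let $R$ be a set of functions $\mathcal{C}\to\mathbb{R}^{\ge0}$. (i) If $\mathcal{C}'$ is parameter-interpretable in $\mathcal{C}$ and $\mathcal{C}$ is an $R$-m.a.c. (resp. $R$-m.e.c.) in $L$, then $\mathcal{C}'$ is a weak $\mathrm{Frac}(R)$-m.a.c. (resp. weak $\mathrm{Frac}(R)$-m.e.c.) in $L'$. (ii) If $\mathcal{C}'$ is weakly bi-interpretable in $\mathcal{C}$ and $\mathcal{C}$ is an $R$-m.a.c. (resp. $R$-m.e.c.) in $L$, then $\mathcal{C}'$ is a $\mathrm{Frac}(R)$-m.a.c. (resp. $\mathrm{Frac}(R)$-m.e.c.) in $L'$. (iii) If $\mathcal{C}'$ is parameter-definable in $\mathcal{C}$ and $\mathcal{C}$ is a weak $R$-m.a.c. (resp. weak $R$-m.e.c.) in $L$, then $\mathcal{C}'$ is a weak $R$-m.a.c. (resp. weak $R$-m.e.c.) in $L'$.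
   Context: Definition of m.a.c. and m.e.c. For a tuple $\bar y$ of variables, $(\mathcal{C},\bar y)$ denotes the set of pairs $(M,\bar a)$ with $M\in\mathcal{C}$, $\bar a\in M^{|\bar y|}$. A partition $\Pi$ of $(\mathcal{C},\bar y)$ is $\emptyset$-definable if for each $\pi\in\Pi$ there is a parameter-free $L$-formula $\phi_\pi(\bar y)$ with $\phi_\pi(M^{|\bar y|})=\{\bar b\in M^{|\bar{y}|}:(M,\bar b)\in\pi\}$ for all $M\in\mathcal{C}$. $\mathcal{C}$ is an $R$-m.a.c. if for every $L$-formula $\phi(\bar x;\bar y)$ there is a finite $\emptyset$-definable partition $\Pi$ of $(\mathcal{C},\bar y)$ and functions $h_\pi\in R$ ($\pi\in\Pi$) such that for each $\pi\in\Pi$ and every $\epsilon>0$ there is $Q\in\mathbb{N}$ such that for all $(M,\bar b)\in\pi$ with $|M|>Q$, $\big||\phi(M^{|\bar x|};\bar b)|-h_\pi(M)\big|\le\epsilon h_\pi(M)$. $\mathcal{C}$ is an $R$-m.e.c. if instead $|\phi(M^{|\bar x|};\bar b)|=h_\pi(M)$ for all $(M,\bar b)\in\pi$. "Weak" means that the $\emptyset$-definability of $\Pi$ is dropped. $\mathrm{Frac}(R)$ is the set of functions $\mathcal{C}\to\mathbb{R}^{\ge0}$ of the form $M\mapsto\sum_{i=1}^n \frac{g_i(M)}{h_i(M)}$ with $n\ge1$, $g_i,h_i\in R$, where $\frac{g_i(M)}{h_i(M)}$ is defined to be $0$ if $h_i(M)=0$. Interpretability. $N$ is $A$-interpretable in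 $M$ if it is isomorphic to a structure with domain a quotient, by an $A$-definable equivalence relation, of an $A$-definable subset of a cartesian power of $M$, with relations induced by $A$-definable relations of $M$. $\mathcal{C}'$ is parameter-interpretable in $\mathcal{C}$ if there is an injection $\alpha:\mathcal{C}'\to\mathcal{C}$ such that each $N\in\mathcal{C}'$ is interpretable with parameters in $\alpha(N)$ uniformly, i.e. through fixed formulas; it is parameter-definable in $\mathcal{C}$ if moreover no quotienting is involved. $N$ is weakly bi-interpretable in $M$ if $N$ is $\emptyset$-interpretable in $M$ via an isomorphism $f:N\to N^*$ ($N^*$ living on a quotient in a power of $M$), $M$ is $\emptyset$-interpretable in $N$ via an isomorphism $g:M\to M^*$, and, where $g^*:N^*\to N^{**}$ is the isomorphism induced by $g$ ($N^{**}$ being interpreted in $M^*$), the isomorphism $g^*\circ f:N\to N^{**}$ is $\emptyset$-definable in $N$. $\mathcal{C}'$ is weakly bi-interpretable in $\mathcal{C}$ if there is a bijection $\alpha:\mathcal{C}'\to\mathcal{C}$ such that each $N\in\mathcal{C}'$ is weakly bi-interpretable in $\alpha(N)$, uniformly (through fixed parameter-free formulas). A function $s$ on $\mathcal{C}$ is regarded as a function on $\mathcal{C}'$ via $s(N):=s(\alpha(N))$. *)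

theory Defs
  imports Complex_Main "HOL-Library.NList" "HOL-Library.FuncSet" "HOL-Library.Disjoint_Sets"
begin

section \<open>First-order logic with equality\<close>

text \<open>Constants are function symbols of arity 0. The symbols of a language form a subset of a
  type, so that a language may have, for instance, no function symbol at all.\<close>

record ('f, 'r) lang =
  fsyms :: "'f set"
  rsyms :: "'r set"
  far :: "'f \<Rightarrow> nat"
  rar :: "'r \<Rightarrow> nat"

datatype 'f tm = Var nat | App 'f "'f tm list"

datatype ('f, 'r) fm =
    Eq "'f tm" "'f tm"
  | Rel 'r "'f tm list"
  | Neg "('f, 'r) fm"
  | Conj "('f, 'r) fm" "('f, 'r) fm"
  | Exists nat "('f, 'r) fm"

primrec wf_tm :: "('f, 'r) lang \<Rightarrow> 'f tm \<Rightarrow> bool" where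
  "wf_tm L (Var i) \<longleftrightarrow> True"
| "wf_tm L (App f ts) \<longleftrightarrow> f \<in> fsyms L \<and> length ts = far L f \<and> list_all (wf_tm L) ts"

primrec wf_fm :: "('f, 'r) lang \<Rightarrow> ('f, 'r) fm \<Rightarrow> bool" where
  "wf_fm L (Eq s t) \<longleftrightarrow> wf_tm L s \<and> wf_tm L t"
| "wf_fm L (Rel r ts) \<longleftrightarrow> r \<in> rsyms L \<and> length ts = rar L r \<and> list_all (wf_tm L) ts"
| "wf_fm L (Neg p) \<longleftrightarrow> wf_fm L p"
| "wf_fm L (Conj p q) \<longleftrightarrow> wf_fm L p \<and> wf_fm L q"
| "wf_fm L (Exists i p) \<longleftrightarrow> wf_fm L p"

primrec fv_tm :: "'f tm \<Rightarrow> nat set" where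
  "fv_tm (Var i) = {i}"
| "fv_tm (App f ts) = \<Union> (set (map fv_tm ts))"

primrec fv :: "('f, 'r) fm \<Rightarrow> nat set" where
  "fv (Eq s t) = fv_tm s \<union> fv_tm t"
| "fv (Rel r ts) = \<Union> (set (map fv_tm ts))"
| "fv (Neg p) = fv p"
| "fv (Conj p q) = fv p \<union> fv q"
| "fv (Exists i p) = fv p - {i}"

text \<open>The formulas of \<open>L\<close> in (at most) \<open>n\<close> free variables, which are always \<open>Var 0, \<dots>, Var (n - 1)\<close>.
  A formula with several tuples of variables uses consecutive segments, in the order displayed:
  \<open>\<phi>(x;y)\<close> with tuples of lengths \<open>n\<close> and \<open>m\<close> is an element of \<open>formulas L (n + m)\<close>.\<close>

definition formulas :: "('f, 'r) lang \<Rightarrow> nat \<Rightarrow> ('f, 'r) fm set" where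
  "formulas L n = {\<phi>. wf_fm L \<phi> \<and> fv \<phi> \<subseteq> {..<n}}"

text \<open>The values of \<open>fun_of\<close> and \<open>rel_of\<close> on symbols outside the language, or on tuples that are
  not over the universe or have the wrong length, are irrelevant.\<close>

record ('a, 'f, 'r) struct =
  univ :: "'a set"
  fun_of :: "'f \<Rightarrow> 'a list \<Rightarrow> 'a"
  rel_of :: "'r \<Rightarrow> 'a list set"

definition is_struct :: "('f, 'r) lang \<Rightarrow> ('a, 'f, 'r) struct \<Rightarrow> bool" where
  "is_struct L M \<longleftrightarrow> univ M \<noteq> {} \<and>
     (\<forall>f\<in>fsyms L. \<forall>xs\<in>nlists (far L f) (univ M). fun_of M f xs \<in> univ M)"

primrec val :: "('a, 'f, 'r) struct \<Rightarrow> (nat \<Rightarrow> 'a) \<Rightarrow> 'f tm \<Rightarrow> 'a" where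
  "val M e (Var i) = e i"
| "val M e (App f ts) = fun_of M f (map (val M e) ts)"

primrec sat :: "('a, 'f, 'r) struct \<Rightarrow> (nat \<Rightarrow> 'a) \<Rightarrow> ('f, 'r) fm \<Rightarrow> bool" where
  "sat M e (Eq s t) \<longleftrightarrow> val M e s = val M e t"
| "sat M e (Rel r ts) \<longleftrightarrow> map (val M e) ts \<in> rel_of M r"
| "sat M e (Neg p) \<longleftrightarrow> \<not> sat M e p"
| "sat M e (Conj p q) \<longleftrightarrow> sat M e p \<and> sat M e q"
| "sat M e (Exists i p) \<longleftrightarrow> (\<exists>a\<in>univ M. sat M (e(i := a)) p)"

text \<open>\<open>M \<Turnstile> \<phi>(a)\<close> for a tuple \<open>a\<close>; meant for \<open>\<phi> \<in> formulas L (length a)\<close>.\<close>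

definition holds :: "('a, 'f, 'r) struct \<Rightarrow> ('f, 'r) fm \<Rightarrow> 'a list \<Rightarrow> bool" where
  "holds M \<phi> a \<longleftrightarrow> sat M (\<lambda>i. a ! i) \<phi>"

definition def_set :: "('a, 'f, 'r) struct \<Rightarrow> ('f, 'r) fm \<Rightarrow> nat \<Rightarrow> 'a list \<Rightarrow> 'a list set" where
  "def_set M \<phi> n b = {a \<in> nlists n (univ M). holds M \<phi> (a @ b)}"

definition is_iso ::
  "('f, 'r) lang \<Rightarrow> ('a, 'f, 'r) struct \<Rightarrow> ('b, 'f, 'r) struct \<Rightarrow> ('a \<Rightarrow> 'b) \<Rightarrow> bool" where
  "is_iso L M N h \<longleftrightarrow> bij_betw h (univ M) (univ N) \<and>
     (\<forall>f\<in>fsyms L. \<forall>xs\<in>nlists (far L f) (univ M). h (fun_of M f xs) = fun_of N f (map h xs)) \<and>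
     (\<forall>r\<in>rsyms L. \<forall>xs\<in>nlists (rar L r) (univ M). xs \<in> rel_of M r \<longleftrightarrow> map h xs \<in> rel_of N r)"


section \<open>Multidimensional asymptotic and exact classes\<close>

definition finite_class :: "('f, 'r) lang \<Rightarrow> ('a, 'f, 'r) struct set \<Rightarrow> bool" where
  "finite_class L C \<longleftrightarrow> (\<forall>M\<in>C. is_struct L M \<and> finite (univ M))"

definition pointed ::
  "('a, 'f, 'r) struct set \<Rightarrow> nat \<Rightarrow> (('a, 'f, 'r) struct \<times> 'a list) set" where
  "pointed C m = {(M, b). M \<in> C \<and> b \<in> nlists m (univ M)}"

definition definable_partition ::
  "('f, 'r) lang \<Rightarrow> ('a, 'f, 'r) struct set \<Rightarrow> nat
    \<Rightarrow> (('a, 'f, 'r) struct \<times> 'a list) set set \<Rightarrow> bool" where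
  "definable_partition L C m P \<longleftrightarrow>
     (\<forall>p\<in>P. \<exists>\<psi>\<in>formulas L m. \<forall>M\<in>C. def_set M \<psi> m [] = {b \<in> nlists m (univ M). (M, b) \<in> p})"

definition asymp_size ::
  "('f, 'r) fm \<Rightarrow> nat \<Rightarrow> (('a, 'f, 'r) struct \<times> 'a list) set
    \<Rightarrow> (('a, 'f, 'r) struct \<Rightarrow> real) \<Rightarrow> bool" where
  "asymp_size \<phi> n p h \<longleftrightarrow>
     (\<forall>\<epsilon>>0. \<exists>Q::nat. \<forall>(M, b)\<in>p. card (univ M) > Q \<longrightarrow>
        \<bar>real (card (def_set M \<phi> n b)) - h M\<bar> \<le> \<epsilon> * h M)"

definition exact_size ::
  "('f, 'r) fm \<Rightarrow> nat \<Rightarrow> (('a, 'f, 'r) struct \<times> 'a list) set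
    \<Rightarrow> (('a, 'f, 'r) struct \<Rightarrow> real) \<Rightarrow> bool" where
  "exact_size \<phi> n p h \<longleftrightarrow> (\<forall>(M, b)\<in>p. real (card (def_set M \<phi> n b)) = h M)"

text \<open>A function on a class \<open>C\<close> is represented by a function on the whole type of structures, of
  which only the values on \<open>C\<close> matter.\<close>

definition weak_mac ::
  "('f, 'r) lang \<Rightarrow> (('a, 'f, 'r) struct \<Rightarrow> real) set \<Rightarrow> ('a, 'f, 'r) struct set \<Rightarrow> bool" where
  "weak_mac L R C \<longleftrightarrow>
     (\<forall>n m. \<forall>\<phi>\<in>formulas L (n + m). \<exists>P h. finite P \<and> partition_on (pointed C m) P \<and>
        (\<forall>p\<in>P. h p \<in> R \<and> asymp_size \<phi> n p (h p)))"

definition mac ::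
  "('f, 'r) lang \<Rightarrow> (('a, 'f, 'r) struct \<Rightarrow> real) set \<Rightarrow> ('a, 'f, 'r) struct set \<Rightarrow> bool" where
  "mac L R C \<longleftrightarrow>
     (\<forall>n m. \<forall>\<phi>\<in>formulas L (n + m). \<exists>P h. finite P \<and> partition_on (pointed C m) P \<and>
        definable_partition L C m P \<and>
        (\<forall>p\<in>P. h p \<in> R \<and> asymp_size \<phi> n p (h p)))"

definition weak_mec ::
  "('f, 'r) lang \<Rightarrow> (('a, 'f, 'r) struct \<Rightarrow> real) set \<Rightarrow> ('a, 'f, 'r) struct set \<Rightarrow> bool" where
  "weak_mec L R C \<longleftrightarrow>
     (\<forall>n m. \<forall>\<phi>\<in>formulas L (n + m). \<exists>P h. finite P \<and> partition_on (pointed C m) P \<and>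
        (\<forall>p\<in>P. h p \<in> R \<and> exact_size \<phi> n p (h p)))"

definition mec ::
  "('f, 'r) lang \<Rightarrow> (('a, 'f, 'r) struct \<Rightarrow> real) set \<Rightarrow> ('a, 'f, 'r) struct set \<Rightarrow> bool" where
  "mec L R C \<longleftrightarrow>
     (\<forall>n m. \<forall>\<phi>\<in>formulas L (n + m). \<exists>P h. finite P \<and> partition_on (pointed C m) P \<and>
        definable_partition L C m P \<and>
        (\<forall>p\<in>P. h p \<in> R \<and> exact_size \<phi> n p (h p)))"

text \<open>Real division satisfies \<open>x / 0 = 0\<close>, which is the convention wanted here.\<close>

definition Frac :: "('s \<Rightarrow> real) set \<Rightarrow> ('s \<Rightarrow> real) set" where
  "Frac R = {F. \<exists>n\<ge>1. \<exists>g h :: nat \<Rightarrow> 's \<Rightarrow> real.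
     (\<forall>i\<in>{1..n}. g i \<in> R \<and> h i \<in> R) \<and> F = (\<lambda>M. \<Sum>i=1..n. g i M / h i M)}"

definition pullback :: "('t \<Rightarrow> 's) \<Rightarrow> ('s \<Rightarrow> real) set \<Rightarrow> ('t \<Rightarrow> real) set" where
  "pullback \<alpha> R = (\<lambda>s. s \<circ> \<alpha>) ` R"


section \<open>Interpretations\<close>

text \<open>A scheme for interpreting structures in the language with symbols \<open>'g, 's\<close> in structures in the
  language with symbols \<open>'f, 'r\<close>, by formulas that take a tuple of \<open>npar\<close> parameters as their last
  arguments. A function symbol is interpreted through its graph, with the value as the last
  argument before the parameters.\<close>

record ('f, 'r, 'g, 's) scheme =
  idim :: nat
  npar :: nat
  dom_fm :: "('f, 'r) fm"
  eq_fm :: "('f, 'r) fm"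
  fun_fm :: "'g \<Rightarrow> ('f, 'r) fm"
  rel_fm :: "'s \<Rightarrow> ('f, 'r) fm"

definition is_scheme ::
  "('g, 's) lang \<Rightarrow> ('f, 'r) lang \<Rightarrow> ('f, 'r, 'g, 's) scheme \<Rightarrow> bool" where
  "is_scheme L' L I \<longleftrightarrow>
     dom_fm I \<in> formulas L (idim I + npar I) \<and>
     eq_fm I \<in> formulas L (idim I + idim I + npar I) \<and>
     (\<forall>f\<in>fsyms L'. fun_fm I f \<in> formulas L (far L' f * idim I + idim I + npar I)) \<and>
     (\<forall>r\<in>rsyms L'. rel_fm I r \<in> formulas L (rar L' r * idim I + npar I))"

definition idom ::
  "('f, 'r, 'g, 's) scheme \<Rightarrow> ('a, 'f, 'r) struct \<Rightarrow> 'a list \<Rightarrow> 'a list set" where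
  "idom I M c = def_set M (dom_fm I) (idim I) c"

definition ieq ::
  "('f, 'r, 'g, 's) scheme \<Rightarrow> ('a, 'f, 'r) struct \<Rightarrow> 'a list \<Rightarrow> ('a list \<times> 'a list) set" where
  "ieq I M c = {(a, a'). a \<in> idom I M c \<and> a' \<in> idom I M c \<and> holds M (eq_fm I) (a @ a' @ c)}"

definition icls ::
  "('f, 'r, 'g, 's) scheme \<Rightarrow> ('a, 'f, 'r) struct \<Rightarrow> 'a list \<Rightarrow> 'a list \<Rightarrow> 'a list set" where
  "icls I M c a = ieq I M c `` {a}"

definition irel ::
  "('g, 's) lang \<Rightarrow> ('f, 'r, 'g, 's) scheme \<Rightarrow> ('a, 'f, 'r) struct \<Rightarrow> 'a list
    \<Rightarrow> 's \<Rightarrow> 'a list set list set" where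
  "irel L' I M c r = {map (icls I M c) as | as.
     as \<in> nlists (rar L' r) (idom I M c) \<and> holds M (rel_fm I r) (concat as @ c)}"

definition igraph ::
  "('g, 's) lang \<Rightarrow> ('f, 'r, 'g, 's) scheme \<Rightarrow> ('a, 'f, 'r) struct \<Rightarrow> 'a list
    \<Rightarrow> 'g \<Rightarrow> ('a list set list \<times> 'a list set) set" where
  "igraph L' I M c f = {(map (icls I M c) as, icls I M c a) | as a.
     as \<in> nlists (far L' f) (idom I M c) \<and> a \<in> idom I M c \<and>
     holds M (fun_fm I f) (concat as @ a @ c)}"

text \<open>The conditions under which the scheme, applied to \<open>M\<close> and \<open>c\<close>, yields a structure.\<close>

definition admissible ::
  "('g, 's) lang \<Rightarrow> ('f, 'r, 'g, 's) scheme \<Rightarrow> ('a, 'f, 'r) struct \<Rightarrow> 'a list \<Rightarrow> bool" where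
  "admissible L' I M c \<longleftrightarrow>
     equiv (idom I M c) (ieq I M c) \<and>
     (\<forall>f\<in>fsyms L'. \<forall>Xs\<in>nlists (far L' f) (idom I M c // ieq I M c).
        \<exists>!Y. (Xs, Y) \<in> igraph L' I M c f)"

definition interp ::
  "('g, 's) lang \<Rightarrow> ('f, 'r, 'g, 's) scheme \<Rightarrow> ('a, 'f, 'r) struct \<Rightarrow> 'a list
    \<Rightarrow> ('a list set, 'g, 's) struct" where
  "interp L' I M c =
     \<lparr>univ = idom I M c // ieq I M c,
      fun_of = (\<lambda>f Xs. THE Y. (Xs, Y) \<in> igraph L' I M c f),
      rel_of = irel L' I M c\<rparr>"

definition interpreted_via ::
  "('g, 's) lang \<Rightarrow> ('f, 'r, 'g, 's) scheme \<Rightarrow> ('b, 'g, 's) struct \<Rightarrow> ('a, 'f, 'r) struct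
    \<Rightarrow> 'a list \<Rightarrow> ('b \<Rightarrow> 'a list set) \<Rightarrow> bool" where
  "interpreted_via L' I N M c h \<longleftrightarrow>
     c \<in> nlists (npar I) (univ M) \<and> admissible L' I M c \<and> is_iso L' N (interp L' I M c) h"

definition param_interpretable ::
  "('g, 's) lang \<Rightarrow> ('b, 'g, 's) struct set \<Rightarrow> ('f, 'r) lang \<Rightarrow> ('a, 'f, 'r) struct set
    \<Rightarrow> (('b, 'g, 's) struct \<Rightarrow> ('a, 'f, 'r) struct) \<Rightarrow> bool" where
  "param_interpretable L' C' L C \<alpha> \<longleftrightarrow>
     \<alpha> \<in> C' \<rightarrow> C \<and> inj_on \<alpha> C' \<and>
     (\<exists>I. is_scheme L' L I \<and> (\<forall>N\<in>C'. \<exists>c h. interpreted_via L' I N (\<alpha> N) c h))"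

text \<open>Absence of quotienting: the equivalence relation is equality, so the classes are singletons.\<close>

definition param_definable ::
  "('g, 's) lang \<Rightarrow> ('b, 'g, 's) struct set \<Rightarrow> ('f, 'r) lang \<Rightarrow> ('a, 'f, 'r) struct set
    \<Rightarrow> (('b, 'g, 's) struct \<Rightarrow> ('a, 'f, 'r) struct) \<Rightarrow> bool" where
  "param_definable L' C' L C \<alpha> \<longleftrightarrow>
     \<alpha> \<in> C' \<rightarrow> C \<and> inj_on \<alpha> C' \<and>
     (\<exists>I. is_scheme L' L I \<and>
        (\<forall>N\<in>C'. \<exists>c h. interpreted_via L' I N (\<alpha> N) c h \<and> ieq I (\<alpha> N) c = Id_on (idom I (\<alpha> N) c)))"

text \<open>Suppose \<open>N\<close> is interpreted in \<open>M\<close> by \<open>I\<close> via \<open>f : N \<rightarrow> N*\<close>, and \<open>M\<close> in \<open>N\<close> by \<open>J\<close> via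
  \<open>g : M \<rightarrow> M*\<close>. An element of \<open>N*\<close> is a class of \<open>idim I\<close>-tuples from \<open>M\<close>, and the isomorphism
  \<open>g* : N* \<rightarrow> N**\<close> induced by \<open>g\<close> sends it to its image under the coordinatewise action of \<open>g\<close>; here
  \<open>N**\<close> is \<open>interp L' I (interp L J N []) []\<close>.\<close>

definition induced_iso :: "('a \<Rightarrow> 'c) \<Rightarrow> 'a list set \<Rightarrow> 'c list set" where
  "induced_iso g X = map g ` X"

text \<open>An element of \<open>N**\<close> is a class of \<open>idim I\<close>-tuples of classes of \<open>idim J\<close>-tuples from \<open>N\<close>.
  A map from \<open>N\<close> to \<open>N**\<close> is definable by \<open>\<chi>\<close> if \<open>\<chi>\<close> defines the preimage of its graph
  in \<open>N \<times> (N^(idim J))^(idim I)\<close>.\<close>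

definition defines_map ::
  "('f, 'r, 'g, 's) scheme \<Rightarrow> ('g, 's, 'f, 'r) scheme \<Rightarrow> ('b, 'g, 's) struct
    \<Rightarrow> ('g, 's) fm \<Rightarrow> ('b \<Rightarrow> 'b list set list set) \<Rightarrow> bool" where
  "defines_map I J N \<chi> F \<longleftrightarrow>
     (\<forall>b\<in>univ N. \<forall>cs\<in>nlists (idim I) (nlists (idim J) (univ N)).
        holds N \<chi> (b # concat cs) \<longleftrightarrow>
        set cs \<subseteq> idom J N [] \<and> map (icls J N []) cs \<in> F b)"

definition weakly_bi_interpretable ::
  "('g, 's) lang \<Rightarrow> ('b, 'g, 's) struct set \<Rightarrow> ('f, 'r) lang \<Rightarrow> ('a, 'f, 'r) struct set
    \<Rightarrow> (('b, 'g, 's) struct \<Rightarrow> ('a, 'f, 'r) struct) \<Rightarrow> bool" where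
  "weakly_bi_interpretable L' C' L C \<alpha> \<longleftrightarrow>
     bij_betw \<alpha> C' C \<and>
     (\<exists>I J. \<exists>\<chi>\<in>formulas L' (1 + idim I * idim J).
        is_scheme L' L I \<and> npar I = 0 \<and> is_scheme L L' J \<and> npar J = 0 \<and>
        (\<forall>N\<in>C'. \<exists>f g.
           interpreted_via L' I N (\<alpha> N) [] f \<and>
           interpreted_via L J (\<alpha> N) N [] g \<and>
           defines_map I J N \<chi> (induced_iso g \<circ> f)))"

end

theory Submission
  imports Defs
begin

text \<open>
  Let \<open>N\<close> be interpreted in \<open>M = \<alpha> N\<close> on classes of \<open>d\<close>-tuples, with parameters \<open>c\<close>, and let
  \<open>\<phi>(x; y)\<close> be a formula in the language of \<open>N\<close>. A solution of \<open>\<phi>(x; b)\<close> in \<open>N\<close> is a tuple of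
  classes, hence a class of longer tuples from \<open>M\<close>. The number of solutions is therefore the sum of
  \<open>1 / |class of x|\<close> over the tuples \<open>x\<close> from \<open>M\<close> that represent a solution. Both ingredients are
  definable in \<open>M\<close>: these tuples by a formula \<open>\<phi>'(x; b', c)\<close>, where \<open>b'\<close> represents \<open>b\<close>, and the class
  of \<open>x\<close> by a formula with parameters \<open>x, c\<close> (theorem \<open>ex_counting_formulas\<close>).

  Suppose that \<open>C\<close> is an \<open>R\<close>-m.a.c. The pairs \<open>(x, c)\<close> fall into finitely many definable pieces \<open>q\<close>,
  and on \<open>q\<close> the class of \<open>x\<close> has about \<open>e\<^sub>q(M)\<close> elements. As \<open>q\<close> is definable, the tuples \<open>x\<close> with
  \<open>\<phi>'(x; b', c)\<close> and \<open>(x, c)\<close> in \<open>q\<close> are the solutions of another formula, and on a suitable piece of the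
  pairs \<open>(b', c)\<close> there are about \<open>g\<^sub>q(M)\<close> of them. Together they contribute about \<open>g\<^sub>q(M) / e\<^sub>q(M)\<close>, so
  \<open>\<phi>(x; b)\<close> has about \<open>\<Sum>\<^sub>q g\<^sub>q(M) / e\<^sub>q(M)\<close> solutions, and this function is in \<open>Frac R\<close> (theorem
  \<open>transfer_Frac\<close>). A class may well be spread over several pieces \<open>q\<close>; this is harmless because each
  tuple is counted with the size of its own class. If there is no quotienting, then all classes are
  singletons and \<open>\<phi>'\<close> alone gives the count, with a function from \<open>R\<close> (theorem
  \<open>transfer_definable\<close>).

  The pairs \<open>(N, b)\<close> are partitioned by the set of those pieces of the pairs \<open>(M, (b', c))\<close> that contain
  a representation of \<open>b\<close>. For a weak bi-interpretation this partition is definable: \<open>M\<close> lives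
  inside \<open>N\<close>, so a formula about \<open>b'\<close> becomes one about tuples of \<open>N\<close>, and the definability of the
  isomorphism from \<open>N\<close> to its copy inside its own copy of \<open>M\<close> expresses in \<open>N\<close> that such a tuple stands
  for a representation of \<open>b\<close> (lemma \<open>codes_definable\<close>).

  The translation of formulas, in either direction, is one induction on formulas (theorem
  \<open>formula\<close> of the locale \<open>relation_system\<close>). The asymptotic and the exact case are treated together
  by a notion of approximation that has both as instances (\<open>size_close\<close>).
\<close>

(* Combined with the unfolding of nlists_def, these two rewrite rules make the simplifier loop. *)
declare nlistsE_length [simp del] nlistsE_set [simp del]

section \<open>Tuples as lists\<close>

lemma map_nth_upt: "b \<le> length xs \<Longrightarrow> map ((!) xs) [a..<b] = drop a (take b xs)"
  by (rule nth_equalityI) auto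

lemma nlists_SucE:
  assumes "xs \<in> nlists (Suc n) A"
  obtains y ys where "xs = y # ys" "y \<in> A" "ys \<in> nlists n A"
  using assms unfolding in_nlists_Suc_iff by blast

lemma length_concat_nlists: "xss \<in> nlists n (nlists d A) \<Longrightarrow> length (concat xss) = n * d"
proof (induction n arbitrary: xss)
  case (Suc n)
  then show ?case by (auto simp: in_nlists_Suc_iff nlistsE_length)
qed simp

lemma concat_nlists: "xss \<in> nlists n (nlists d A) \<Longrightarrow> concat xss \<in> nlists (n * d) A"
  by (rule nlistsI) (auto simp: length_concat_nlists nlists_def)

lemma nlists_split:
  assumes "xs \<in> nlists (n + m) A"
  obtains ys zs where "xs = ys @ zs" "ys \<in> nlists n A" "zs \<in> nlists m A"
proof
  show "xs = take n xs @ drop n xs" by simp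
  show "take n xs \<in> nlists n A" "drop n xs \<in> nlists m A"
    using assms set_take_subset[of n xs] set_drop_subset[of n xs] unfolding nlists_def
    by (simp_all add: subset_trans[of _ "set xs" A])
qed

lemma nlists_concat_cases:
  assumes "xs \<in> nlists (n * d) A"
  obtains xss where "xss \<in> nlists n (nlists d A)" "xs = concat xss"
proof -
  have "xs \<in> nlists (n * d) A \<Longrightarrow> \<exists>xss\<in>nlists n (nlists d A). xs = concat xss"
  proof (induction n arbitrary: xs)
    case (Suc n)
    from Suc.prems obtain ys zs where "xs = ys @ zs" "ys \<in> nlists d A" "zs \<in> nlists (n * d) A"
      by (auto elim: nlists_split)
    with Suc.IH[of zs] show ?case
      by (metis Cons_in_nlists_Suc concat.simps(2))
  qed simp
  with assms that show thesis by blast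
qed

lemma inj_on_concat_nlists: "inj_on concat (nlists n (nlists d A))"
proof (induction n)
  case (Suc n)
  show ?case
  proof (rule inj_onI)
    fix xss yss
    assume "xss \<in> nlists (Suc n) (nlists d A)" and "yss \<in> nlists (Suc n) (nlists d A)"
      and eq: "concat xss = concat yss"
    obtain x xs where x: "xss = x # xs" "x \<in> nlists d A" "xs \<in> nlists n (nlists d A)"
      using \<open>xss \<in> _\<close> by (rule nlists_SucE)
    obtain y ys where y: "yss = y # ys" "y \<in> nlists d A" "ys \<in> nlists n (nlists d A)"
      using \<open>yss \<in> _\<close> by (rule nlists_SucE)
    have "x = y \<and> concat xs = concat ys"
      using eq nlistsE_length[OF x(2)] nlistsE_length[OF y(2)] unfolding x(1) y(1)
      by simp
    then show "xss = yss"
      using x(1,3) y(1,3) inj_onD[OF Suc.IH, of xs ys] by blast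
  qed
qed simp

lemma concat_segment:
  assumes "xss \<in> nlists n (nlists d A)" "k < n"
  shows "take d (drop (k * d) (concat xss @ zs)) = xss ! k"
  using assms
proof (induction k arbitrary: xss n)
  case 0
  then show ?case by (cases n) (auto simp: in_nlists_Suc_iff nlistsE_length)
next
  case (Suc k)
  then obtain n' where n: "n = Suc n'" "k < n'" by (cases n) auto
  with Suc.prems obtain x xs where xs: "xss = x # xs" "x \<in> nlists d A" "xs \<in> nlists n' (nlists d A)"
    by (auto elim: nlists_SucE)
  from xs(2) have "length x = d" by (rule nlistsE_length)
  then show ?case using xs(1) Suc.IH[OF xs(3) n(2)] by simp
qed

lemma nlists_eq_map_image: "nlists n (f ` A) = map f ` nlists n A"
proof (induction n)
  case (Suc n)
  then show ?case by (auto simp: nlists_Suc image_iff)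
qed simp

lemma inj_on_map_nlists: "inj_on f A \<Longrightarrow> inj_on (map f) (nlists n A)"
proof (rule inj_onI)
  fix xs ys assume *: "inj_on f A" "xs \<in> nlists n A" "ys \<in> nlists n A" "map f xs = map f ys"
  have "inj_on f (set xs \<union> set ys)"
    by (rule inj_on_subset[OF *(1)]) (use nlistsE_set[OF *(2)] nlistsE_set[OF *(3)] in simp)
  with *(4) show "xs = ys" by (rule map_inj_on)
qed

lemma nlists_conv_lists: "nlists n A = {xs. set xs \<subseteq> A \<and> length xs = n}"
  unfolding nlists_def by blast

lemma card_nlists: "finite A \<Longrightarrow> card (nlists n A) = card A ^ n"
  unfolding nlists_conv_lists by (rule card_lists_length_eq)

lemma finite_nlists: "finite A \<Longrightarrow> finite (nlists n A)"
  unfolding nlists_conv_lists by (rule finite_lists_length_eq)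

lemma map_nth_segment: "a + l \<le> length xs \<Longrightarrow> map ((!) xs) [a..<a + l] = take l (drop a xs)"
  by (simp add: map_nth_upt take_drop add.commute)

lemma segment_in_nlists: "a + l \<le> m \<Longrightarrow> [a..<a + l] \<in> nlists l {..<m}"
  by (auto simp: nlists_def)

lemma in_nlists_iff_nth: "xs \<in> nlists n A \<longleftrightarrow> length xs = n \<and> (\<forall>k<n. xs ! k \<in> A)"
  by (auto simp: nlists_def set_conv_nth)

lemma map_nth_in_nlists: "xs \<in> nlists n A \<Longrightarrow> is \<in> nlists l {..<n} \<Longrightarrow> map ((!) xs) is \<in> nlists l A"
  by (auto simp: nlists_def subset_iff)

lemma concat_map_concat: "concat (map concat xsss) = concat (concat xsss)"
  by (induction xsss) simp_all

section \<open>Relations defined by formulas\<close>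

lemma val_cong: "(\<And>i. i \<in> fv_tm t \<Longrightarrow> e i = e' i) \<Longrightarrow> val M e t = val M e' t"
proof (induction t)
  case (App f ts)
  have "val M e t = val M e' t" if "t \<in> set ts" for t
    by (rule App.IH[OF that]) (use App.prems that in auto)
  then have "map (val M e) ts = map (val M e') ts" by simp
  then show ?case by (simp only: val.simps)
qed simp

lemma sat_cong: "(\<And>i. i \<in> fv \<phi> \<Longrightarrow> e i = e' i) \<Longrightarrow> sat M e \<phi> \<longleftrightarrow> sat M e' \<phi>"
proof (induction \<phi> arbitrary: e e')
  case (Eq s t)
  have "val M e s = val M e' s" "val M e t = val M e' t"
    by (rule val_cong; use Eq.prems in simp)+
  then show ?case by simp
next
  case (Rel r ts)
  have "val M e t = val M e' t" if "t \<in> set ts" for t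
    by (rule val_cong) (use Rel.prems that in auto)
  then have "map (val M e) ts = map (val M e') ts" by simp
  then show ?case by (simp only: sat.simps)
next
  case (Exists i \<phi>)
  have "sat M (e(i := a)) \<phi> \<longleftrightarrow> sat M (e'(i := a)) \<phi>" for a
    by (rule Exists.IH) (use Exists.prems in auto)
  then show ?case by simp
next
  case (Neg \<phi>)
  have "sat M e \<phi> \<longleftrightarrow> sat M e' \<phi>"
    by (rule Neg.IH) (use Neg.prems in simp)
  then show ?case by simp
next
  case (Conj \<phi> \<psi>)
  have "sat M e \<phi> \<longleftrightarrow> sat M e' \<phi>" "sat M e \<psi> \<longleftrightarrow> sat M e' \<psi>"
    by (rule Conj.IH; use Conj.prems in simp)+
  then show ?case by simp
qed

lemma val_in_univ:
  assumes "is_struct L M" "wf_tm L t" "\<And>i. i \<in> fv_tm t \<Longrightarrow> e i \<in> univ M"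
  shows "val M e t \<in> univ M"
  using assms(2,3)
proof (induction t)
  case (App f ts)
  have "val M e t \<in> univ M" if "t \<in> set ts" for t
    by (rule App.IH[OF that]) (use App.prems that in \<open>auto simp: list_all_iff\<close>)
  then have "map (val M e) ts \<in> nlists (far L f) (univ M)"
    using App.prems(1) by (auto simp: nlists_def)
  with App.prems(1) assms(1) show ?case
    by (simp add: is_struct_def)
qed simp

text \<open>Families of relations, uniform over the structures in \<open>C\<close>, with the closure properties of the
  relations that formulas define. Among the atoms only those without nested terms are required.
  Such a family contains every relation defined by a formula, so each instance of the locale turns
  into a theorem about all formulas: the definable relations yield substitution of variables, and
  the relations that can be expressed through an interpretation yield the translation of formulas.\<close>

locale relation_system =
  fixes L :: "('f, 'r) lang" and C :: "('a, 'f, 'r) struct set"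
    and \<D> :: "nat \<Rightarrow> (('a, 'f, 'r) struct \<Rightarrow> 'a list \<Rightarrow> bool) \<Rightarrow> bool"
  assumes structures: "M \<in> C \<Longrightarrow> is_struct L M"
    and cong: "\<D> n X \<Longrightarrow> (\<And>M xs. M \<in> C \<Longrightarrow> xs \<in> nlists n (univ M) \<Longrightarrow> X M xs \<longleftrightarrow> Y M xs) \<Longrightarrow> \<D> n Y"
    and neg: "\<D> n X \<Longrightarrow> \<D> n (\<lambda>M xs. \<not> X M xs)"
    and conj: "\<D> n X \<Longrightarrow> \<D> n Y \<Longrightarrow> \<D> n (\<lambda>M xs. X M xs \<and> Y M xs)"
    and ex1: "\<D> (Suc n) X \<Longrightarrow> \<D> n (\<lambda>M xs. \<exists>a\<in>univ M. X M (xs @ [a]))"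
    and eq_atom: "i < n \<Longrightarrow> j < n \<Longrightarrow> \<D> n (\<lambda>M xs. xs ! i = xs ! j)"
    and fun_atom: "f \<in> fsyms L \<Longrightarrow> is \<in> nlists (far L f) {..<n} \<Longrightarrow> j < n \<Longrightarrow>
      \<D> n (\<lambda>M xs. fun_of M f (map ((!) xs) is) = xs ! j)"
    and rel_atom: "r \<in> rsyms L \<Longrightarrow> is \<in> nlists (rar L r) {..<n} \<Longrightarrow>
      \<D> n (\<lambda>M xs. map ((!) xs) is \<in> rel_of M r)"
begin

lemma true: "\<D> n (\<lambda>M xs. True)"
proof -
  \<comment> \<open>For \<open>n = 0\<close> there is no entry to form an atom with; the quantifier supplies one.\<close>
  have "\<D> n (\<lambda>M xs. \<exists>a\<in>univ M. (xs @ [a]) ! n = (xs @ [a]) ! n)"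
    by (rule ex1) (rule eq_atom; simp)
  then show ?thesis
    by (rule cong) (use structures in \<open>force simp: is_struct_def\<close>)
qed

lemma ball:
  assumes "finite F" "\<And>k. k \<in> F \<Longrightarrow> \<D> n (X k)"
  shows "\<D> n (\<lambda>M xs. \<forall>k\<in>F. X k M xs)"
  using assms
proof (induction F)
  case empty
  show ?case by (rule cong[OF true]) simp
next
  case (insert k F)
  have "\<D> n (\<lambda>M xs. X k M xs \<and> (\<forall>k\<in>F. X k M xs))"
    by (rule conj) (use insert in auto)
  then show ?case by (rule cong) simp
qed

lemma ex:
  assumes "\<D> (n + m) X"
  shows "\<D> n (\<lambda>M xs. \<exists>ys\<in>nlists m (univ M). X M (xs @ ys))"
  using assms
proof (induction m arbitrary: n)
  case 0
  then show ?case by simp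
next
  case (Suc m)
  then have "\<D> (Suc n) (\<lambda>M xs. \<exists>ys\<in>nlists m (univ M). X M (xs @ ys))" by simp
  from ex1[OF this] show ?case
    by (rule cong) (simp add: nlists_Suc)
qed

text \<open>Nested terms are eliminated by naming their values:
  \<open>A(t\<^sub>1, \<dots>, t\<^sub>l)\<close> says that there are \<open>y\<^sub>1, \<dots>, y\<^sub>l\<close> with \<open>t\<^sub>k = y\<^sub>k\<close> for all \<open>k\<close> and \<open>A(y\<^sub>1, \<dots>, y\<^sub>l)\<close>.\<close>

lemma flatten:
  assumes atom: "\<D> (n + length ts) (\<lambda>M zs. A M (take n zs) (drop n zs))"
    and ts: "\<And>k. k < length ts \<Longrightarrow>
      \<D> (n + length ts) (\<lambda>M zs. val M (\<lambda>w. zs ! \<rho> w) (ts ! k) = zs ! (n + k))"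
    and wf: "\<And>t. t \<in> set ts \<Longrightarrow> wf_tm L t \<and> (\<forall>w\<in>fv_tm t. \<rho> w < n)"
  shows "\<D> n (\<lambda>M xs. A M xs (map (val M (\<lambda>w. xs ! \<rho> w)) ts))"
proof -
  let ?l = "length ts"
  have "\<D> (n + ?l) (\<lambda>M zs. (\<forall>k\<in>{..<?l}. val M (\<lambda>w. zs ! \<rho> w) (ts ! k) = zs ! (n + k)) \<and>
      A M (take n zs) (drop n zs))"
    using atom ts by (intro conj ball) auto
  from ex[OF this] show ?thesis
  proof (rule cong)
    fix M :: "('a, 'f, 'r) struct" and xs
    assume M: "M \<in> C" and xs: "xs \<in> nlists n (univ M)"
    let ?vs = "map (val M (\<lambda>w. xs ! \<rho> w)) ts"
    have "val M (\<lambda>w. xs ! \<rho> w) t \<in> univ M" if "t \<in> set ts" for t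
      by (rule val_in_univ[OF structures[OF M]]) (use wf[OF that] nlistsE_nth_in[OF xs] in auto)
    then have vs: "?vs \<in> nlists ?l (univ M)"
      by (intro nlistsI) auto
    have "val M (\<lambda>w. (xs @ ys) ! \<rho> w) (ts ! k) = val M (\<lambda>w. xs ! \<rho> w) (ts ! k)"
      if "k < ?l" for ys k
      by (rule val_cong) (use wf[OF nth_mem[OF that]] nlistsE_length[OF xs] in \<open>auto simp: nth_append\<close>)
    then have "(\<forall>k\<in>{..<?l}. val M (\<lambda>w. (xs @ ys) ! \<rho> w) (ts ! k) = (xs @ ys) ! (n + k)) \<longleftrightarrow> ys = ?vs"
      if "ys \<in> nlists ?l (univ M)" for ys
      using nlistsE_length[OF that] nlistsE_length[OF xs]
      by (auto simp: nth_append list_eq_iff_nth_eq)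
    moreover have "take n (xs @ ys) = xs" "drop n (xs @ ys) = ys" for ys
      using nlistsE_length[OF xs] by simp_all
    ultimately show "(\<exists>ys\<in>nlists ?l (univ M).
        (\<forall>k\<in>{..<?l}. val M (\<lambda>w. (xs @ ys) ! \<rho> w) (ts ! k) = (xs @ ys) ! (n + k)) \<and>
        A M (take n (xs @ ys)) (drop n (xs @ ys))) \<longleftrightarrow> A M xs ?vs"
      using vs by metis
  qed
qed

lemma term_graph:
  assumes "wf_tm L t" "\<And>w. w \<in> fv_tm t \<Longrightarrow> \<rho> w < n" "j < n"
  shows "\<D> n (\<lambda>M xs. val M (\<lambda>w. xs ! \<rho> w) t = xs ! j)"
  using assms
proof (induction t arbitrary: n j)
  case (Var w)
  then show ?case by (simp add: eq_atom)
next
  case (App f ts)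
  let ?l = "length ts"
  have "\<D> (n + ?l) (\<lambda>M zs. fun_of M f (map ((!) zs) [n..<n + ?l]) = zs ! j)"
    by (rule fun_atom) (use App.prems in \<open>auto simp: nlists_def\<close>)
  then have "\<D> (n + ?l) (\<lambda>M zs. fun_of M f (drop n zs) = take n zs ! j)"
    by (rule cong) (use App.prems in \<open>simp add: map_nth_upt nlists_def\<close>)
  then have "\<D> n (\<lambda>M xs. fun_of M f (map (val M (\<lambda>w. xs ! \<rho> w)) ts) = xs ! j)"
  proof (rule flatten[where A = "\<lambda>M xs vs. fun_of M f vs = xs ! j"])
    fix k assume "k < ?l"
    then have k: "ts ! k \<in> set ts" by simp
    show "\<D> (n + ?l) (\<lambda>M zs. val M (\<lambda>w. zs ! \<rho> w) (ts ! k) = zs ! (n + k))"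
    proof (rule App.IH[OF k])
      show "wf_tm L (ts ! k)" using App.prems k by (auto simp: list_all_iff)
      show "\<rho> w < n + ?l" if "w \<in> fv_tm (ts ! k)" for w
        using App.prems(2)[of w] k that by force
    qed (use \<open>k < ?l\<close> in simp)
  qed (use App.prems in \<open>auto simp: list_all_iff\<close>)
  then show ?case by simp
qed

text \<open>The map \<open>\<rho>\<close> says which entry of the tuple is the value of which variable. This makes the
  induction work: a quantifier appends an entry and redirects the bound variable to it, so the names
  of bound variables cannot interfere with the positions in the tuple.\<close>

theorem formula:
  assumes "wf_fm L \<phi>" "\<And>w. w \<in> fv \<phi> \<Longrightarrow> \<rho> w < n"
  shows "\<D> n (\<lambda>M xs. sat M (\<lambda>w. xs ! \<rho> w) \<phi>)"
  using assms
proof (induction \<phi> arbitrary: n \<rho>)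
  case (Eq s t)
  have "\<D> (n + 2) (\<lambda>M zs. zs ! n = zs ! (n + 1))" by (rule eq_atom) simp_all
  then have "\<D> (n + length [s, t]) (\<lambda>M zs. drop n zs ! 0 = drop n zs ! 1)"
    unfolding list.size by (simp add: numeral_2_eq_2) (rule cong, assumption, simp add: nlists_def)
  then have "\<D> n (\<lambda>M xs. map (val M (\<lambda>w. xs ! \<rho> w)) [s, t] ! 0 = map (val M (\<lambda>w. xs ! \<rho> w)) [s, t] ! 1)"
  proof (rule flatten[where A = "\<lambda>M xs vs. vs ! 0 = vs ! 1"])
    fix k assume k: "k < length [s, t]"
    then have "[s, t] ! k = s \<or> [s, t] ! k = t" by (cases k) auto
    moreover have "\<rho> w < n + length [s, t]" if "w \<in> fv_tm s \<or> w \<in> fv_tm t" for w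
      using Eq.prems(2)[of w] that by force
    ultimately show "\<D> (n + length [s, t]) (\<lambda>M zs. val M (\<lambda>w. zs ! \<rho> w) ([s, t] ! k) = zs ! (n + k))"
      using k Eq.prems(1) by (intro term_graph) auto
  qed (use Eq.prems in auto)
  then show ?case by simp
next
  case (Rel r ts)
  let ?l = "length ts"
  have "\<D> (n + ?l) (\<lambda>M zs. map ((!) zs) [n..<n + ?l] \<in> rel_of M r)"
    by (rule rel_atom) (use Rel.prems in \<open>auto simp: nlists_def\<close>)
  then have "\<D> (n + ?l) (\<lambda>M zs. drop n zs \<in> rel_of M r)"
    by (rule cong) (simp add: map_nth_upt nlists_def)
  then have "\<D> n (\<lambda>M xs. map (val M (\<lambda>w. xs ! \<rho> w)) ts \<in> rel_of M r)"
  proof (rule flatten[where A = "\<lambda>M xs vs. vs \<in> rel_of M r"])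
    fix k assume "k < ?l"
    then have k: "ts ! k \<in> set ts" by simp
    show "\<D> (n + ?l) (\<lambda>M zs. val M (\<lambda>w. zs ! \<rho> w) (ts ! k) = zs ! (n + k))"
    proof (rule term_graph)
      show "wf_tm L (ts ! k)" using Rel.prems k by (auto simp: list_all_iff)
      show "\<rho> w < n + ?l" if "w \<in> fv_tm (ts ! k)" for w
        using Rel.prems(2)[of w] k that by force
    qed (use \<open>k < ?l\<close> in simp)
  qed (use Rel.prems in \<open>auto simp: list_all_iff\<close>)
  then show ?case by simp
next
  case (Neg \<phi>)
  then show ?case by (simp add: neg)
next
  case (Conj \<phi> \<psi>)
  then show ?case by (simp add: conj)
next
  case (Exists i \<phi>)
  have "\<D> (Suc n) (\<lambda>M xs. sat M (\<lambda>w. xs ! (\<rho>(i := n)) w) \<phi>)"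
    by (rule Exists.IH) (use Exists.prems in \<open>auto simp: less_SucI\<close>)
  from ex1[OF this] show ?case
  proof (rule cong)
    fix M :: "('a, 'f, 'r) struct" and xs
    assume xs: "xs \<in> nlists n (univ M)"
    have "sat M (\<lambda>w. (xs @ [a]) ! (\<rho>(i := n)) w) \<phi> \<longleftrightarrow> sat M ((\<lambda>w. xs ! \<rho> w)(i := a)) \<phi>" for a
      by (rule sat_cong) (use xs Exists.prems(2) in \<open>auto simp: nth_append nlistsE_length\<close>)
    then show "(\<exists>a\<in>univ M. sat M (\<lambda>w. (xs @ [a]) ! (\<rho>(i := n)) w) \<phi>) \<longleftrightarrow>
        sat M (\<lambda>w. xs ! \<rho> w) (Exists i \<phi>)"
      by simp
  qed
qed

corollary holds_formula:
  assumes "\<phi> \<in> formulas L n"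
  shows "\<D> n (\<lambda>M. holds M \<phi>)"
  using formula[of \<phi> "\<lambda>w. w" n] assms by (force simp: formulas_def holds_def[abs_def])

end

definition definable ::
  "('f, 'r) lang \<Rightarrow> ('a, 'f, 'r) struct set \<Rightarrow> nat
    \<Rightarrow> (('a, 'f, 'r) struct \<Rightarrow> 'a list \<Rightarrow> bool) \<Rightarrow> bool" where
  "definable L C n X \<longleftrightarrow>
     (\<exists>\<phi>\<in>formulas L n. \<forall>M\<in>C. \<forall>xs\<in>nlists n (univ M). holds M \<phi> xs \<longleftrightarrow> X M xs)"

lemma definable_relation_system:
  assumes C: "\<And>M. M \<in> C \<Longrightarrow> is_struct L M"
  shows "relation_system L C (definable L C)"
proof
  show "definable L C n Y" if "definable L C n X"
    "\<And>M xs. M \<in> C \<Longrightarrow> xs \<in> nlists n (univ M) \<Longrightarrow> X M xs \<longleftrightarrow> Y M xs" for n X Y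
    using that by (simp add: definable_def)
  show "definable L C n (\<lambda>M xs. \<not> X M xs)" if X: "definable L C n X" for n X
  proof -
    from X obtain \<phi> where "\<phi> \<in> formulas L n"
      "\<forall>M\<in>C. \<forall>xs\<in>nlists n (univ M). holds M \<phi> xs \<longleftrightarrow> X M xs"
      by (auto simp: definable_def)
    then show ?thesis
      unfolding definable_def by (intro bexI[of _ "Neg \<phi>"]) (auto simp: formulas_def holds_def)
  qed
  show "definable L C n (\<lambda>M xs. X M xs \<and> Y M xs)"
    if XY: "definable L C n X" "definable L C n Y" for n X Y
  proof -
    from XY obtain \<phi> \<psi> where "\<phi> \<in> formulas L n" "\<psi> \<in> formulas L n"
      "\<forall>M\<in>C. \<forall>xs\<in>nlists n (univ M). holds M \<phi> xs \<longleftrightarrow> X M xs"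
      "\<forall>M\<in>C. \<forall>xs\<in>nlists n (univ M). holds M \<psi> xs \<longleftrightarrow> Y M xs"
      by (auto simp: definable_def)
    then show ?thesis
      unfolding definable_def by (intro bexI[of _ "Conj \<phi> \<psi>"]) (auto simp: formulas_def holds_def)
  qed
  show "definable L C n (\<lambda>M xs. \<exists>a\<in>univ M. X M (xs @ [a]))" if X: "definable L C (Suc n) X" for n X
  proof -
    from X obtain \<phi> where \<phi>: "\<phi> \<in> formulas L (Suc n)"
      and def: "\<forall>M\<in>C. \<forall>xs\<in>nlists (Suc n) (univ M). holds M \<phi> xs \<longleftrightarrow> X M xs"
      by (auto simp: definable_def)
    have "holds M (Exists n \<phi>) xs \<longleftrightarrow> (\<exists>a\<in>univ M. X M (xs @ [a]))"
      if M: "M \<in> C" and xs: "xs \<in> nlists n (univ M)" for M xs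
    proof -
      have "sat M (((!) xs)(n := a)) \<phi> \<longleftrightarrow> X M (xs @ [a])" if "a \<in> univ M" for a
      proof -
        have "xs @ [a] \<in> nlists (Suc n) (univ M)"
          using that xs by (auto simp: nlists_def)
        with def M have "X M (xs @ [a]) \<longleftrightarrow> sat M ((!) (xs @ [a])) \<phi>"
          by (simp add: holds_def)
        also have "\<dots> \<longleftrightarrow> sat M (((!) xs)(n := a)) \<phi>"
          by (rule sat_cong) (use \<phi> xs in \<open>auto simp: formulas_def nth_append nlistsE_length\<close>)
        finally show ?thesis by simp
      qed
      then show ?thesis by (simp add: holds_def)
    qed
    moreover have "Exists n \<phi> \<in> formulas L n"
      using \<phi> by (auto simp: formulas_def less_Suc_eq)
    ultimately show ?thesis unfolding definable_def by blast
  qed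
  show "definable L C n (\<lambda>M xs. xs ! i = xs ! j)" if "i < n" "j < n" for n i j
    unfolding definable_def
    by (intro bexI[of _ "Eq (Var i) (Var j)"]) (use that in \<open>auto simp: formulas_def holds_def\<close>)
  show "definable L C n (\<lambda>M xs. fun_of M f (map ((!) xs) is) = xs ! j)"
    if "f \<in> fsyms L" "is \<in> nlists (far L f) {..<n}" "j < n" for f "is" n j
    unfolding definable_def
    by (intro bexI[of _ "Eq (App f (map Var is)) (Var j)"])
      (use that in \<open>auto simp: formulas_def holds_def list_all_iff nlists_def comp_def\<close>)
  show "definable L C n (\<lambda>M xs. map ((!) xs) is \<in> rel_of M r)"
    if "r \<in> rsyms L" "is \<in> nlists (rar L r) {..<n}" for r "is" n
    unfolding definable_def
    by (intro bexI[of _ "Rel r (map Var is)"])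
      (use that in \<open>auto simp: formulas_def holds_def list_all_iff nlists_def comp_def\<close>)
qed (rule C)

text \<open>This amounts to capture-avoiding substitution of variables for variables, but no substitution
  has to be defined: the map \<open>\<rho>\<close> of theorem \<open>formula\<close> does it.\<close>

lemma definable_subst:
  assumes C: "\<And>M. M \<in> C \<Longrightarrow> is_struct L M"
    and X: "definable L C n X" and vs: "vs \<in> nlists n {..<m}"
  shows "definable L C m (\<lambda>M xs. X M (map ((!) xs) vs))"
proof -
  interpret relation_system L C "definable L C" by (rule definable_relation_system[OF C])
  from X obtain \<phi> where \<phi>: "\<phi> \<in> formulas L n"
    and def: "\<forall>M\<in>C. \<forall>xs\<in>nlists n (univ M). holds M \<phi> xs \<longleftrightarrow> X M xs"
    by (auto simp: definable_def)
  have "vs ! w < m" if "w \<in> fv \<phi>" for w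
    using \<phi> nlistsE_nth_in[OF vs, of w] that by (auto simp: formulas_def)
  then have "definable L C m (\<lambda>M xs. sat M (\<lambda>w. xs ! (vs ! w)) \<phi>)"
    using \<phi> by (intro formula) (auto simp: formulas_def)
  then show ?thesis
  proof (rule cong)
    fix M :: "('a, 'b, 'c) struct" and xs
    assume M: "M \<in> C" and xs: "xs \<in> nlists m (univ M)"
    have "map ((!) xs) vs \<in> nlists n (univ M)"
      using xs vs by (fastforce simp: nlists_def)
    with def M have "X M (map ((!) xs) vs) \<longleftrightarrow> sat M ((!) (map ((!) xs) vs)) \<phi>"
      by (simp add: holds_def)
    also have "\<dots> \<longleftrightarrow> sat M (\<lambda>w. xs ! (vs ! w)) \<phi>"
      by (rule sat_cong) (use \<phi> vs in \<open>auto simp: formulas_def nlists_def\<close>)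
    finally show "sat M (\<lambda>w. xs ! (vs ! w)) \<phi> \<longleftrightarrow> X M (map ((!) xs) vs)" by simp
  qed
qed

section \<open>Uniform interpretations\<close>

text \<open>For each \<open>N\<close> the parameters \<open>c N\<close> and the isomorphism \<open>h N\<close> are chosen once and for all. An element
  of \<open>N\<close> is represented by the \<open>d\<close>-tuples in its class under \<open>h N\<close>, and an \<open>n\<close>-tuple of elements by a
  list of \<open>n\<close> such \<open>d\<close>-tuples. Formulas over \<open>\<alpha> N\<close> take the concatenation of this list, followed by
  \<open>c N\<close>.\<close>

locale uniform_interpretation =
  fixes L' :: "('g, 's) lang" and C' :: "('b, 'g, 's) struct set"
    and L :: "('f, 'r) lang" and C :: "('a, 'f, 'r) struct set"
    and \<alpha> :: "('b, 'g, 's) struct \<Rightarrow> ('a, 'f, 'r) struct"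
    and I :: "('f, 'r, 'g, 's) scheme"
    and c :: "('b, 'g, 's) struct \<Rightarrow> 'a list"
    and h :: "('b, 'g, 's) struct \<Rightarrow> 'b \<Rightarrow> 'a list set"
  assumes finite_C: "finite_class L C" and finite_C': "finite_class L' C'"
    and scheme: "is_scheme L' L I"
    and \<alpha>: "\<alpha> \<in> C' \<rightarrow> C"
    and interpreted: "N \<in> C' \<Longrightarrow> interpreted_via L' I N (\<alpha> N) (c N) (h N)"
begin

abbreviation "d \<equiv> idim I"
abbreviation "p \<equiv> npar I"
abbreviation "dm N \<equiv> idom I (\<alpha> N) (c N)"
abbreviation "cls N \<equiv> icls I (\<alpha> N) (c N)"

lemma struct_C: "M \<in> C \<Longrightarrow> is_struct L M"
  and struct_C': "N \<in> C' \<Longrightarrow> is_struct L' N"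
  using finite_C finite_C' by (auto simp: finite_class_def)

sublocale defin: relation_system L C "definable L C"
  by (rule definable_relation_system[OF struct_C])

lemma defin_subst:
  "definable L C n X \<Longrightarrow> vs \<in> nlists n {..<m} \<Longrightarrow> definable L C m (\<lambda>M xs. X M (map ((!) xs) vs))"
  using definable_subst[of C L] struct_C by blast

lemma \<alpha>_in: "N \<in> C' \<Longrightarrow> \<alpha> N \<in> C"
  using \<alpha> by auto

lemma par_in: "N \<in> C' \<Longrightarrow> c N \<in> nlists p (univ (\<alpha> N))"
  using interpreted by (simp add: interpreted_via_def)

lemma dom_subset: "dm N \<subseteq> nlists d (univ (\<alpha> N))"
  by (auto simp: idom_def def_set_def)

lemma nlists_dom_subset: "nlists n (dm N) \<subseteq> nlists n (nlists d (univ (\<alpha> N)))"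
  by (rule nlists_mono[OF dom_subset])

lemma equiv_ieq: "N \<in> C' \<Longrightarrow> equiv (dm N) (ieq I (\<alpha> N) (c N))"
  using interpreted by (simp add: interpreted_via_def admissible_def)

lemma cls_eq_iff:
  assumes "N \<in> C'" "x \<in> dm N" "y \<in> dm N"
  shows "cls N x = cls N y \<longleftrightarrow> (x, y) \<in> ieq I (\<alpha> N) (c N)"
  using eq_equiv_class_iff[OF equiv_ieq[OF assms(1)] assms(2,3)] by (simp add: icls_def)

lemma h_image: "N \<in> C' \<Longrightarrow> h N ` univ N = cls N ` dm N"
  and inj_h: "N \<in> C' \<Longrightarrow> inj_on (h N) (univ N)"
  using interpreted[of N]
  by (auto simp: interpreted_via_def is_iso_def interp_def bij_betw_def quotient_def icls_def)

lemma ex_representative: "N \<in> C' \<Longrightarrow> b \<in> univ N \<Longrightarrow> \<exists>x\<in>dm N. h N b = cls N x"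
  and ex_element: "N \<in> C' \<Longrightarrow> x \<in> dm N \<Longrightarrow> \<exists>b\<in>univ N. h N b = cls N x"
proof -
  assume "N \<in> C'" "b \<in> univ N"
  with h_image[of N] have "h N b \<in> cls N ` dm N" by blast
  then show "\<exists>x\<in>dm N. h N b = cls N x" by auto
next
  assume "N \<in> C'" "x \<in> dm N"
  with h_image[of N] have "cls N x \<in> h N ` univ N" by simp
  then show "\<exists>b\<in>univ N. h N b = cls N x" by auto
qed

lemma mem_h_iff:
  assumes "N \<in> C'" "b \<in> univ N"
  shows "x \<in> h N b \<longleftrightarrow> x \<in> dm N \<and> h N b = cls N x"
proof -
  obtain y where y: "y \<in> dm N" "h N b = cls N y" using ex_representative[OF assms] by blast
  have "x \<in> cls N y \<longleftrightarrow> (y, x) \<in> ieq I (\<alpha> N) (c N)" by (simp add: icls_def)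
  also have "\<dots> \<longleftrightarrow> x \<in> dm N \<and> cls N y = cls N x"
    using cls_eq_iff[OF assms(1) y(1)] by (auto simp: ieq_def)
  finally show ?thesis by (simp add: y)
qed

lemma h_image_tuples: "N \<in> C' \<Longrightarrow> map (h N) ` nlists n (univ N) = map (cls N) ` nlists n (dm N)"
  by (simp add: h_image flip: nlists_eq_map_image)

lemma obtain_representatives:
  assumes "N \<in> C'" "bs \<in> nlists n (univ N)"
  obtains as where "as \<in> nlists n (dm N)" "map (h N) bs = map (cls N) as"
proof -
  have "map (h N) bs \<in> map (cls N) ` nlists n (dm N)"
    unfolding h_image_tuples[OF assms(1), symmetric] using assms(2) by (rule imageI)
  then show thesis using that by auto
qed

lemma obtain_elements:
  assumes "N \<in> C'" "as \<in> nlists n (dm N)"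
  obtains bs where "bs \<in> nlists n (univ N)" "map (h N) bs = map (cls N) as"
proof -
  have "map (cls N) as \<in> map (h N) ` nlists n (univ N)"
    unfolding h_image_tuples[OF assms(1)] using assms(2) by (rule imageI)
  then show thesis using that by auto
qed

lemma concat_dom_in:
  assumes "as \<in> nlists n (dm N)"
  shows "concat as \<in> nlists (n * d) (univ (\<alpha> N))"
  by (rule concat_nlists[OF subsetD[OF nlists_dom_subset assms]])

lemma length_concat_dom: "as \<in> nlists n (dm N) \<Longrightarrow> length (concat as) = n * d"
  by (rule nlistsE_length[OF concat_dom_in])

text \<open>Equality of whole tuples of classes, because the solutions to be counted are tuples. Membership
  in the domain of the interpretation is included, so that \<open>E\<close> can also serve to express it.\<close>

definition same_class_formula :: "nat \<Rightarrow> ('f, 'r) fm \<Rightarrow> bool" where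
  "same_class_formula n E \<longleftrightarrow> E \<in> formulas L (n * d + (n * d + p)) \<and>
     (\<forall>N as as'. N \<in> C' \<longrightarrow> as \<in> nlists n (nlists d (univ (\<alpha> N))) \<longrightarrow>
        as' \<in> nlists n (nlists d (univ (\<alpha> N))) \<longrightarrow>
        (holds (\<alpha> N) E (concat as @ concat as' @ c N) \<longleftrightarrow>
          as \<in> nlists n (dm N) \<and> as' \<in> nlists n (dm N) \<and> map (cls N) as = map (cls N) as'))"

lemma same_class_formulaD:
  assumes "same_class_formula n E"
  shows "E \<in> formulas L (n * d + (n * d + p))"
    and "\<And>N as as'. N \<in> C' \<Longrightarrow> as \<in> nlists n (nlists d (univ (\<alpha> N))) \<Longrightarrow>
      as' \<in> nlists n (nlists d (univ (\<alpha> N))) \<Longrightarrow>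
      holds (\<alpha> N) E (concat as @ concat as' @ c N) \<longleftrightarrow>
        as \<in> nlists n (dm N) \<and> as' \<in> nlists n (dm N) \<and> map (cls N) as = map (cls N) as'"
  using assms unfolding same_class_formula_def by simp_all

lemma ex_same_class_formula: "\<exists>E. same_class_formula n E"
proof -
  let ?m = "n * d + (n * d + p)"
  let ?u = "\<lambda>k. [k * d..<k * d + d]" and ?v = "\<lambda>k. [n * d + k * d..<n * d + k * d + d]"
    and ?w = "[n * d + n * d..<n * d + n * d + p]"
  let ?X = "\<lambda>M zs. \<forall>k\<in>{..<n}. holds M (dom_fm I) (map ((!) zs) (?u k @ ?w)) \<and>
      holds M (dom_fm I) (map ((!) zs) (?v k @ ?w)) \<and>
      holds M (eq_fm I) (map ((!) zs) (?u k @ ?v k @ ?w))"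
  have bound: "k * d + d \<le> n * d" if "k < n" for k
    using mult_le_mono1[of "Suc k" n d] that by simp
  have "definable L C ?m ?X"
  proof (intro defin.ball defin.conj defin_subst defin.holds_formula)
    show "dom_fm I \<in> formulas L (d + p)" "dom_fm I \<in> formulas L (d + p)"
      "eq_fm I \<in> formulas L (d + (d + p))"
      using scheme by (simp_all add: is_scheme_def add.assoc)
    fix k assume "k \<in> {..<n}"
    then have "k < n" by simp
    from bound[OF this]
    show "?u k @ ?w \<in> nlists (d + p) {..<?m}" "?v k @ ?w \<in> nlists (d + p) {..<?m}"
      "?u k @ ?v k @ ?w \<in> nlists (d + (d + p)) {..<?m}"
      by (intro nlists_appendI segment_in_nlists; simp)+
  qed simp_all
  then obtain E where E: "E \<in> formulas L ?m"
    and def: "\<And>M zs. M \<in> C \<Longrightarrow> zs \<in> nlists ?m (univ M) \<Longrightarrow> holds M E zs \<longleftrightarrow> ?X M zs"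
    unfolding definable_def by blast
  show ?thesis
    unfolding same_class_formula_def
  proof (intro exI[of _ E] conjI E allI impI)
    fix N as as'
    assume N: "N \<in> C'" and as: "as \<in> nlists n (nlists d (univ (\<alpha> N)))"
      and as': "as' \<in> nlists n (nlists d (univ (\<alpha> N)))"
    let ?zs = "concat as @ concat as' @ c N"
    note len = length_concat_nlists[OF as] length_concat_nlists[OF as'] nlistsE_length[OF par_in[OF N]]
    have zs: "?zs \<in> nlists ?m (univ (\<alpha> N))"
      by (intro nlists_appendI concat_nlists[OF as] concat_nlists[OF as'] par_in N)
    have u: "map ((!) ?zs) (?u k) = as ! k" and v: "map ((!) ?zs) (?v k) = as' ! k" if "k < n" for k
      using bound[OF that] concat_segment[OF as that] concat_segment[OF as' that]
      by (subst map_nth_segment; simp add: len)+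
    have w: "map ((!) ?zs) ?w = c N"
      by (subst map_nth_segment; simp add: len)
    have mem: "x \<in> dm N \<longleftrightarrow> holds (\<alpha> N) (dom_fm I) (x @ c N)" if "x \<in> nlists d (univ (\<alpha> N))" for x
      using that by (simp add: idom_def def_set_def)
    have "holds (\<alpha> N) E ?zs \<longleftrightarrow> ?X (\<alpha> N) ?zs"
      by (rule def[OF \<alpha>_in[OF N] zs])
    also have "\<dots> \<longleftrightarrow> (\<forall>k<n. as ! k \<in> dm N \<and> as' ! k \<in> dm N \<and>
        holds (\<alpha> N) (eq_fm I) (as ! k @ as' ! k @ c N))"
      using mem nlistsE_nth_in[OF as] nlistsE_nth_in[OF as'] by (auto simp: u v w)
    also have "\<dots> \<longleftrightarrow> (\<forall>k<n. as ! k \<in> dm N \<and> as' ! k \<in> dm N \<and> cls N (as ! k) = cls N (as' ! k))"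
      using cls_eq_iff[OF N] by (auto simp: ieq_def)
    also have "\<dots> \<longleftrightarrow> as \<in> nlists n (dm N) \<and> as' \<in> nlists n (dm N) \<and> map (cls N) as = map (cls N) as'"
      using nlistsE_length[OF as] nlistsE_length[OF as']
      by (auto simp: in_nlists_iff_nth list_eq_iff_nth_eq[of "map _ _"])
    finally show "holds (\<alpha> N) E ?zs \<longleftrightarrow>
        as \<in> nlists n (dm N) \<and> as' \<in> nlists n (dm N) \<and> map (cls N) as = map (cls N) as'" .
  qed
qed

text \<open>The formulas of a scheme need not be invariant under the equivalence relation: a relation holds
  of classes if its formula holds of some representatives. For arbitrary representatives the right
  formula is therefore the saturation of the given one.\<close>

lemma saturation_definable:
  assumes \<theta>: "\<theta> \<in> formulas L (n * d + p)"
  obtains X where "definable L C (n * d + p) X"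
    and "\<And>N as. N \<in> C' \<Longrightarrow> as \<in> nlists n (dm N) \<Longrightarrow>
      X (\<alpha> N) (concat as @ c N) \<longleftrightarrow>
        (\<exists>as'\<in>nlists n (dm N). map (cls N) as' = map (cls N) as \<and> holds (\<alpha> N) \<theta> (concat as' @ c N))"
proof -
  obtain E where "same_class_formula n E"
    using ex_same_class_formula by blast
  note E = same_class_formulaD(1)[OF this] and E_iff = same_class_formulaD(2)[OF this]
  let ?m = "n * d + p + n * d"
  let ?x = "[0..<0 + n * d]" and ?w = "[n * d..<n * d + p]" and ?y = "[n * d + p..<n * d + p + n * d]"
  let ?X = "\<lambda>M zs. \<exists>ys\<in>nlists (n * d) (univ M).
      holds M E (map ((!) (zs @ ys)) (?x @ ?y @ ?w)) \<and> holds M \<theta> (map ((!) (zs @ ys)) (?y @ ?w))"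
  have "definable L C (n * d + p) ?X"
  proof (intro defin.ex[where X = "\<lambda>M zs. holds M E (map ((!) zs) (?x @ ?y @ ?w)) \<and>
      holds M \<theta> (map ((!) zs) (?y @ ?w))"] defin.conj defin_subst defin.holds_formula E \<theta>)
    show "?x @ ?y @ ?w \<in> nlists (n * d + (n * d + p)) {..<?m}"
      "?y @ ?w \<in> nlists (n * d + p) {..<?m}"
      by (intro nlists_appendI segment_in_nlists; simp)+
  qed (use E \<theta> in simp_all)
  then show thesis
  proof (rule that)
    fix N as assume N: "N \<in> C'" and as: "as \<in> nlists n (dm N)"
    note as_univ = subsetD[OF nlists_dom_subset as]
    have seg: "map ((!) ((concat as @ c N) @ ys)) ?x = concat as"
      "map ((!) ((concat as @ c N) @ ys)) ?w = c N"
      "map ((!) ((concat as @ c N) @ ys)) ?y = ys" if "length ys = n * d" for ys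
      using that length_concat_dom[OF as] nlistsE_length[OF par_in[OF N]]
      by (subst map_nth_segment; simp)+
    have "?X (\<alpha> N) (concat as @ c N) \<longleftrightarrow> (\<exists>ys\<in>nlists (n * d) (univ (\<alpha> N)).
        holds (\<alpha> N) E (concat as @ ys @ c N) \<and> holds (\<alpha> N) \<theta> (ys @ c N))"
      by (rule bex_cong[OF refl]) (simp only: map_append seg nlistsE_length)
    also have "\<dots> \<longleftrightarrow> (\<exists>as'\<in>nlists n (nlists d (univ (\<alpha> N))).
        holds (\<alpha> N) E (concat as @ concat as' @ c N) \<and> holds (\<alpha> N) \<theta> (concat as' @ c N))"
      by (metis concat_nlists nlists_concat_cases)
    also have "\<dots> \<longleftrightarrow> (\<exists>as'\<in>nlists n (dm N).
        map (cls N) as' = map (cls N) as \<and> holds (\<alpha> N) \<theta> (concat as' @ c N))"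
      using E_iff[OF N as_univ] as nlists_dom_subset[of n N] by (auto simp: subset_iff)
    finally show "?X (\<alpha> N) (concat as @ c N) \<longleftrightarrow> (\<exists>as'\<in>nlists n (dm N).
        map (cls N) as' = map (cls N) as \<and> holds (\<alpha> N) \<theta> (concat as' @ c N))" .
  qed
qed

text \<open>The equivalence is required for every choice of representatives. For a negation this is what
  lets the negated formula serve as its translation.\<close>

definition translatable :: "nat \<Rightarrow> (('b, 'g, 's) struct \<Rightarrow> 'b list \<Rightarrow> bool) \<Rightarrow> bool" where
  "translatable n Y \<longleftrightarrow> (\<exists>X. definable L C (n * d + p) X \<and>
     (\<forall>N\<in>C'. \<forall>bs\<in>nlists n (univ N). \<forall>as\<in>nlists n (dm N). map (h N) bs = map (cls N) as \<longrightarrow>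
        (Y N bs \<longleftrightarrow> X (\<alpha> N) (concat as @ c N))))"

lemma translatableI:
  assumes "definable L C (n * d + p) X"
    and "\<And>N bs as. N \<in> C' \<Longrightarrow> bs \<in> nlists n (univ N) \<Longrightarrow> as \<in> nlists n (dm N) \<Longrightarrow>
      map (h N) bs = map (cls N) as \<Longrightarrow> Y N bs \<longleftrightarrow> X (\<alpha> N) (concat as @ c N)"
  shows "translatable n Y"
  using assms unfolding translatable_def by blast

lemma translatableE:
  assumes "translatable n Y"
  obtains X where "definable L C (n * d + p) X"
    and "\<And>N bs as. N \<in> C' \<Longrightarrow> bs \<in> nlists n (univ N) \<Longrightarrow> as \<in> nlists n (dm N) \<Longrightarrow>
      map (h N) bs = map (cls N) as \<Longrightarrow> Y N bs \<longleftrightarrow> X (\<alpha> N) (concat as @ c N)"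
  using assms unfolding translatable_def by blast

text \<open>The common form of all atoms: \<open>Y\<close> says that the entries of \<open>bs\<close> at the positions \<open>is\<close> have some
  representatives that satisfy \<open>\<theta>\<close>.\<close>

lemma translatable_saturation:
  assumes \<theta>: "\<theta> \<in> formulas L (l * d + p)" and "is": "is \<in> nlists l {..<n}"
    and Y: "\<And>N bs. N \<in> C' \<Longrightarrow> bs \<in> nlists n (univ N) \<Longrightarrow>
      Y N bs \<longleftrightarrow> (\<exists>as'\<in>nlists l (dm N). map (cls N) as' = map (h N) (map ((!) bs) is) \<and>
        holds (\<alpha> N) \<theta> (concat as' @ c N))"
  shows "translatable n Y"
proof -
  obtain X where X: "definable L C (l * d + p) X"
    and X_iff: "\<And>N as. N \<in> C' \<Longrightarrow> as \<in> nlists l (dm N) \<Longrightarrow>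
      X (\<alpha> N) (concat as @ c N) \<longleftrightarrow>
        (\<exists>as'\<in>nlists l (dm N). map (cls N) as' = map (cls N) as \<and> holds (\<alpha> N) \<theta> (concat as' @ c N))"
    using \<theta> by (rule saturation_definable) blast
  let ?us = "map (\<lambda>i. [i * d..<i * d + d]) is" and ?w = "[n * d..<n * d + p]"
  have bound: "i * d + d \<le> n * d" if "i < n" for i
    using mult_le_mono1[of "Suc i" n d] that by simp
  have "?us \<in> nlists l (nlists d {..<n * d + p})"
  proof (rule nlistsI)
    have "[i * d..<i * d + d] \<in> nlists d {..<n * d + p}" if "i < n" for i
      using bound[OF that] by (intro segment_in_nlists) simp
    then show "set ?us \<subseteq> nlists d {..<n * d + p}"
      using nlistsE_set[OF "is"] by auto
  qed (use nlistsE_length[OF "is"] in simp)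
  then have "concat ?us @ ?w \<in> nlists (l * d + p) {..<n * d + p}"
    by (intro nlists_appendI concat_nlists segment_in_nlists) simp_all
  then have "definable L C (n * d + p) (\<lambda>M zs. X M (map ((!) zs) (concat ?us @ ?w)))"
    by (rule defin_subst[OF X])
  then show ?thesis
  proof (rule translatableI)
    fix N bs as
    assume N: "N \<in> C'" and bs: "bs \<in> nlists n (univ N)" and as: "as \<in> nlists n (dm N)"
      and eq: "map (h N) bs = map (cls N) as"
    note as_univ = subsetD[OF nlists_dom_subset as]
    let ?zs = "concat as @ c N" and ?as = "map ((!) as) is"
    note len = length_concat_dom[OF as] nlistsE_length[OF par_in[OF N]]
    have "map ((!) ?zs) [i * d..<i * d + d] = as ! i" if "i \<in> set is" for i
    proof -
      have "i < n" using that nlistsE_set[OF "is"] by auto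
      then show ?thesis
        using bound concat_segment[OF as_univ] by (subst map_nth_segment) (auto simp: len intro: trans_le_add1)
    qed
    then have "map ((!) ?zs) (concat ?us) = concat ?as"
      by (simp add: map_concat comp_def cong: map_cong)
    moreover have "map ((!) ?zs) ?w = c N"
      by (subst map_nth_segment; simp add: len)
    ultimately have zs: "map ((!) ?zs) (concat ?us @ ?w) = concat ?as @ c N" by simp
    have as': "?as \<in> nlists l (dm N)"
      using as "is" by (rule map_nth_in_nlists)
    have "cls N (as ! i) = h N (bs ! i)" if "i < n" for i
      using arg_cong[OF eq, of "\<lambda>xs. xs ! i"] that nlistsE_length[OF as] nlistsE_length[OF bs] by simp
    then have eq_is: "map (cls N) ?as = map (h N) (map ((!) bs) is)"
      using nlistsE_set[OF "is"] by auto
    then show "Y N bs \<longleftrightarrow> X (\<alpha> N) (map ((!) ?zs) (concat ?us @ ?w))"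
      unfolding zs X_iff[OF N as'] Y[OF N bs] by (simp only: eq_is)
  qed
qed

lemma translatable_ex:
  assumes "translatable (Suc n) Y"
  shows "translatable n (\<lambda>N bs. \<exists>b\<in>univ N. Y N (bs @ [b]))"
proof -
  obtain X where X: "definable L C (Suc n * d + p) X"
    and X_iff: "\<And>N bs as. N \<in> C' \<Longrightarrow> bs \<in> nlists (Suc n) (univ N) \<Longrightarrow> as \<in> nlists (Suc n) (dm N) \<Longrightarrow>
      map (h N) bs = map (cls N) as \<Longrightarrow> Y N bs \<longleftrightarrow> X (\<alpha> N) (concat as @ c N)"
    using assms by (rule translatableE) blast
  let ?x = "[0..<0 + n * d]" and ?w = "[n * d..<n * d + p]" and ?y = "[n * d + p..<n * d + p + d]"
  have "definable L C (n * d + p) (\<lambda>M zs. \<exists>y\<in>nlists d (univ M).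
      holds M (dom_fm I) (map ((!) (zs @ y)) (?y @ ?w)) \<and> X M (map ((!) (zs @ y)) ((?x @ ?y) @ ?w)))"
  proof (intro defin.ex[where X = "\<lambda>M zs. holds M (dom_fm I) (map ((!) zs) (?y @ ?w)) \<and>
      X M (map ((!) zs) ((?x @ ?y) @ ?w))"] defin.conj defin_subst defin.holds_formula X)
    show "dom_fm I \<in> formulas L (d + p)" using scheme by (simp add: is_scheme_def)
    have *: "Suc n * d + p = (n * d + d) + p" by simp
    show "(?x @ ?y) @ ?w \<in> nlists (Suc n * d + p) {..<n * d + p + d}"
      "?y @ ?w \<in> nlists (d + p) {..<n * d + p + d}"
      unfolding * by (intro nlists_appendI segment_in_nlists; simp)+
  qed (rule X)
  then show ?thesis
  proof (rule translatableI)
    fix N bs as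
    assume N: "N \<in> C'" and bs: "bs \<in> nlists n (univ N)" and as: "as \<in> nlists n (dm N)"
      and eq: "map (h N) bs = map (cls N) as"
    have seg: "map ((!) ((concat as @ c N) @ y)) ?x = concat as"
      "map ((!) ((concat as @ c N) @ y)) ?w = c N"
      "map ((!) ((concat as @ c N) @ y)) ?y = y" if "length y = d" for y
      using that length_concat_dom[OF as] nlistsE_length[OF par_in[OF N]]
      by (subst map_nth_segment; simp)+
    have Y_iff: "Y N (bs @ [b]) \<longleftrightarrow> X (\<alpha> N) ((concat as @ y) @ c N)"
      if "b \<in> univ N" "y \<in> dm N" "h N b = cls N y" for b y
      using X_iff[OF N, of "bs @ [b]" "as @ [y]"] nlists_appendI[OF bs, of "[b]" 1]
        nlists_appendI[OF as, of "[y]" 1] eq that by simp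
    have "(\<exists>y\<in>nlists d (univ (\<alpha> N)).
        holds (\<alpha> N) (dom_fm I) (map ((!) ((concat as @ c N) @ y)) (?y @ ?w)) \<and>
        X (\<alpha> N) (map ((!) ((concat as @ c N) @ y)) ((?x @ ?y) @ ?w))) \<longleftrightarrow>
      (\<exists>y\<in>nlists d (univ (\<alpha> N)). holds (\<alpha> N) (dom_fm I) (y @ c N) \<and>
        X (\<alpha> N) ((concat as @ y) @ c N))"
      by (rule bex_cong[OF refl]) (simp only: map_append seg nlistsE_length)
    also have "\<dots> \<longleftrightarrow> (\<exists>y\<in>dm N. X (\<alpha> N) ((concat as @ y) @ c N))"
      by (auto simp: idom_def def_set_def)
    also have "\<dots> \<longleftrightarrow> (\<exists>b\<in>univ N. Y N (bs @ [b]))"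
      using ex_representative[OF N] ex_element[OF N] Y_iff by blast
    finally show "(\<exists>b\<in>univ N. Y N (bs @ [b])) \<longleftrightarrow> (\<exists>y\<in>nlists d (univ (\<alpha> N)).
        holds (\<alpha> N) (dom_fm I) (map ((!) ((concat as @ c N) @ y)) (?y @ ?w)) \<and>
        X (\<alpha> N) (map ((!) ((concat as @ c N) @ y)) ((?x @ ?y) @ ?w)))" by simp
  qed
qed

lemma translatable_fun:
  assumes f: "f \<in> fsyms L'" and "is": "is \<in> nlists (far L' f) {..<n}" and j: "j < n"
  shows "translatable n (\<lambda>N bs. fun_of N f (map ((!) bs) is) = bs ! j)"
proof (rule translatable_saturation)
  show "fun_fm I f \<in> formulas L ((far L' f + 1) * d + p)"
    using scheme f by (simp add: is_scheme_def ac_simps)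
  show "is @ [j] \<in> nlists (far L' f + 1) {..<n}"
    by (rule nlists_appendI[OF "is"]) (use j in \<open>auto intro: nlistsI\<close>)
  fix N bs assume N: "N \<in> C'" and bs: "bs \<in> nlists n (univ N)"
  let ?xs = "map ((!) bs) is" and ?G = "igraph L' I (\<alpha> N) (c N) f"
  have xs: "?xs \<in> nlists (far L' f) (univ N)"
    using bs "is" by (rule map_nth_in_nlists)
  have bj: "bs ! j \<in> univ N" using nlistsE_nth_in[OF bs j] .
  have iso: "h N (fun_of N f ?xs) = fun_of (interp L' I (\<alpha> N) (c N)) f (map (h N) ?xs)"
    using interpreted[OF N] f xs by (simp add: interpreted_via_def is_iso_def)
  have "map (h N) ?xs \<in> nlists (far L' f) (dm N // ieq I (\<alpha> N) (c N))"
    using imageI[OF xs, of "map (h N)"] interpreted[OF N]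
    by (simp flip: nlists_eq_map_image add: interpreted_via_def is_iso_def bij_betw_def interp_def)
  then have ex1: "\<exists>!y. (map (h N) ?xs, y) \<in> ?G"
    using interpreted[OF N] f unfolding interpreted_via_def admissible_def by blast
  have "fun_of N f ?xs \<in> univ N"
    using struct_C'[OF N] f xs by (simp add: is_struct_def)
  then have "fun_of N f ?xs = bs ! j \<longleftrightarrow> h N (fun_of N f ?xs) = h N (bs ! j)"
    using inj_h[OF N] bj by (simp add: inj_on_eq_iff)
  \<comment> \<open>Admissibility makes \<open>?G\<close> the graph of the function that \<open>interp\<close> defines by \<open>THE\<close>.\<close>
  also have "\<dots> \<longleftrightarrow> (map (h N) ?xs, h N (bs ! j)) \<in> ?G"
    unfolding iso interp_def using ex1 theI'[OF ex1] by auto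
  also have "\<dots> \<longleftrightarrow> (\<exists>as a. map (h N) ?xs = map (cls N) as \<and> h N (bs ! j) = cls N a \<and>
      as \<in> nlists (far L' f) (dm N) \<and> a \<in> dm N \<and> holds (\<alpha> N) (fun_fm I f) (concat as @ a @ c N))"
    unfolding igraph_def by auto
  also have "\<dots> \<longleftrightarrow> (\<exists>as'\<in>nlists (far L' f + 1) (dm N).
      map (cls N) as' = map (h N) (map ((!) bs) (is @ [j])) \<and>
      holds (\<alpha> N) (fun_fm I f) (concat as' @ c N))" (is "?l \<longleftrightarrow> ?r")
  proof
    assume ?l
    then obtain as a where *: "map (h N) ?xs = map (cls N) as" "h N (bs ! j) = cls N a"
      "as \<in> nlists (far L' f) (dm N)" "a \<in> dm N" "holds (\<alpha> N) (fun_fm I f) (concat as @ a @ c N)"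
      by blast
    have "as @ [a] \<in> nlists (far L' f + 1) (dm N)"
      by (rule nlists_appendI[OF *(3)]) (use * in simp)
    with * show ?r by (intro bexI[of _ "as @ [a]"]) simp_all
  next
    assume ?r
    then obtain as' where as': "as' \<in> nlists (far L' f + 1) (dm N)"
      "map (cls N) as' = map (h N) (map ((!) bs) (is @ [j]))"
      "holds (\<alpha> N) (fun_fm I f) (concat as' @ c N)"
      by blast
    from as'(1) obtain as us where us: "as' = as @ us" "as \<in> nlists (far L' f) (dm N)" "us \<in> nlists 1 (dm N)"
      by (rule nlists_split)
    from us(3) obtain a where a: "us = [a]" "a \<in> dm N"
      unfolding One_nat_def by (auto elim: nlists_SucE)
    from as' us a show ?l by (intro exI[of _ as] exI[of _ a]) simp
  qed
  finally show "fun_of N f ?xs = bs ! j \<longleftrightarrow> (\<exists>as'\<in>nlists (far L' f + 1) (dm N).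
      map (cls N) as' = map (h N) (map ((!) bs) (is @ [j])) \<and>
      holds (\<alpha> N) (fun_fm I f) (concat as' @ c N))" .
qed

lemma translatable_rel:
  assumes r: "r \<in> rsyms L'" and "is": "is \<in> nlists (rar L' r) {..<n}"
  shows "translatable n (\<lambda>N bs. map ((!) bs) is \<in> rel_of N r)"
proof (rule translatable_saturation[OF _ "is"])
  show "rel_fm I r \<in> formulas L (rar L' r * d + p)"
    using scheme r by (simp add: is_scheme_def)
  fix N bs assume N: "N \<in> C'" and bs: "bs \<in> nlists n (univ N)"
  let ?xs = "map ((!) bs) is"
  have "?xs \<in> nlists (rar L' r) (univ N)"
    using bs "is" by (rule map_nth_in_nlists)
  then have "?xs \<in> rel_of N r \<longleftrightarrow> map (h N) ?xs \<in> rel_of (interp L' I (\<alpha> N) (c N)) r"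
    using interpreted[OF N] r unfolding interpreted_via_def is_iso_def by blast
  then show "?xs \<in> rel_of N r \<longleftrightarrow> (\<exists>as'\<in>nlists (rar L' r) (dm N).
      map (cls N) as' = map (h N) ?xs \<and> holds (\<alpha> N) (rel_fm I r) (concat as' @ c N))"
    unfolding interp_def irel_def by (auto simp del: map_map)
qed

lemma translatable_eq:
  assumes "i < n" "j < n"
  shows "translatable n (\<lambda>N bs. bs ! i = bs ! j)"
proof -
  obtain E where E: "same_class_formula 1 E"
    using ex_same_class_formula by blast
  note E_iff = same_class_formulaD(2)[OF E]
  from same_class_formulaD(1)[OF E] have "E \<in> formulas L ((1 + 1) * d + p)" by (simp only: add.assoc add_mult_distrib)
  then have "E \<in> formulas L (2 * d + p)" unfolding one_add_one .
  then show ?thesis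
  proof (rule translatable_saturation[of E 2 "[i, j]"])
    show "[i, j] \<in> nlists 2 {..<n}" using assms by (auto intro!: nlistsI)
    fix N bs assume N: "N \<in> C'" and bs: "bs \<in> nlists n (univ N)"
    have b: "bs ! i \<in> univ N" "bs ! j \<in> univ N" using nlistsE_nth_in[OF bs] assms by auto
    have E': "holds (\<alpha> N) E (x @ y @ c N) \<longleftrightarrow> cls N x = cls N y" if "x \<in> dm N" "y \<in> dm N" for x y
      using E_iff[OF N, of "[x]" "[y]"] that dom_subset[of N] by auto
    have two: "(\<exists>as\<in>nlists 2 A. P as) \<longleftrightarrow> (\<exists>x\<in>A. \<exists>y\<in>A. P [x, y])" for A :: "'a list set" and P
      by (auto simp: numeral_2_eq_2 nlists_Suc)
    obtain x y where xy: "x \<in> dm N" "h N (bs ! i) = cls N x" "y \<in> dm N" "h N (bs ! j) = cls N y"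
      using ex_representative[OF N b(1)] ex_representative[OF N b(2)] by blast
    have "bs ! i = bs ! j \<longleftrightarrow> h N (bs ! i) = h N (bs ! j)"
      using inj_h[OF N] b by (simp add: inj_on_eq_iff)
    also have "\<dots> \<longleftrightarrow> (\<exists>x\<in>dm N. \<exists>y\<in>dm N. cls N x = h N (bs ! i) \<and> cls N y = h N (bs ! j) \<and>
        cls N x = cls N y)"
      using xy by (metis (no_types))
    also have "\<dots> \<longleftrightarrow> (\<exists>as'\<in>nlists 2 (dm N).
        map (cls N) as' = map (h N) (map ((!) bs) [i, j]) \<and> holds (\<alpha> N) E (concat as' @ c N))"
      unfolding two by (intro bex_cong refl) (simp add: E')
    finally show "bs ! i = bs ! j \<longleftrightarrow> (\<exists>as'\<in>nlists 2 (dm N).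
        map (cls N) as' = map (h N) (map ((!) bs) [i, j]) \<and> holds (\<alpha> N) E (concat as' @ c N))" .
  qed
qed

sublocale transl: relation_system L' C' translatable
proof
  show "translatable n Z" if "translatable n Y"
    "\<And>M xs. M \<in> C' \<Longrightarrow> xs \<in> nlists n (univ M) \<Longrightarrow> Y M xs \<longleftrightarrow> Z M xs" for n Y Z
    using that(1) by (rule translatableE) (rule translatableI, assumption, simp flip: that(2))
  show "translatable n (\<lambda>N bs. \<not> Y N bs)" if "translatable n Y" for n Y
    using that by (rule translatableE) (rule translatableI, erule defin.neg, simp)
  show "translatable n (\<lambda>N bs. Y N bs \<and> Z N bs)" if "translatable n Y" "translatable n Z" for n Y Z
  proof -
    from that(1) obtain X1 where X1: "definable L C (n * d + p) X1"
      "\<And>N bs as. N \<in> C' \<Longrightarrow> bs \<in> nlists n (univ N) \<Longrightarrow> as \<in> nlists n (dm N) \<Longrightarrow>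
        map (h N) bs = map (cls N) as \<Longrightarrow> Y N bs \<longleftrightarrow> X1 (\<alpha> N) (concat as @ c N)"
      by (rule translatableE) blast
    from that(2) obtain X2 where X2: "definable L C (n * d + p) X2"
      "\<And>N bs as. N \<in> C' \<Longrightarrow> bs \<in> nlists n (univ N) \<Longrightarrow> as \<in> nlists n (dm N) \<Longrightarrow>
        map (h N) bs = map (cls N) as \<Longrightarrow> Z N bs \<longleftrightarrow> X2 (\<alpha> N) (concat as @ c N)"
      by (rule translatableE) blast
    show ?thesis
      by (rule translatableI[OF defin.conj[OF X1(1) X2(1)]]) (simp add: X1(2) X2(2))
  qed
qed (fact struct_C' translatable_ex translatable_eq translatable_fun translatable_rel)+

theorem translation:
  assumes "\<phi> \<in> formulas L' n"
  obtains \<psi> where "\<psi> \<in> formulas L (n * d + p)"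
    and "\<And>N bs as. N \<in> C' \<Longrightarrow> bs \<in> nlists n (univ N) \<Longrightarrow> as \<in> nlists n (dm N) \<Longrightarrow>
      map (h N) bs = map (cls N) as \<Longrightarrow> holds N \<phi> bs \<longleftrightarrow> holds (\<alpha> N) \<psi> (concat as @ c N)"
proof -
  have "translatable n (\<lambda>N. holds N \<phi>)" using assms by (rule transl.holds_formula)
  then obtain X where X: "definable L C (n * d + p) X"
    and iff: "\<And>N bs as. N \<in> C' \<Longrightarrow> bs \<in> nlists n (univ N) \<Longrightarrow> as \<in> nlists n (dm N) \<Longrightarrow>
      map (h N) bs = map (cls N) as \<Longrightarrow> holds N \<phi> bs \<longleftrightarrow> X (\<alpha> N) (concat as @ c N)"
    by (rule translatableE) blast
  from X obtain \<psi> where \<psi>: "\<psi> \<in> formulas L (n * d + p)"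
    and def: "\<And>M xs. M \<in> C \<Longrightarrow> xs \<in> nlists (n * d + p) (univ M) \<Longrightarrow> holds M \<psi> xs \<longleftrightarrow> X M xs"
    unfolding definable_def by blast
  show thesis
  proof (rule that[OF \<psi>])
    fix N bs as
    assume N: "N \<in> C'" and as: "as \<in> nlists n (dm N)"
      and *: "bs \<in> nlists n (univ N)" "map (h N) bs = map (cls N) as"
    have "concat as @ c N \<in> nlists (n * d + p) (univ (\<alpha> N))"
      by (intro nlists_appendI concat_dom_in[OF as] par_in[OF N])
    then show "holds N \<phi> bs \<longleftrightarrow> holds (\<alpha> N) \<psi> (concat as @ c N)"
      using def[OF \<alpha>_in[OF N]] iff[OF N *(1) as *(2)] by simp
  qed
qed

end

section \<open>Counting classes\<close>

text \<open>Each fibre contributes 1 to the sum.\<close>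

lemma card_image_eq_sum_fibres:
  assumes "finite S"
  shows "real (card (F ` S)) = (\<Sum>x\<in>S. 1 / real (card {y \<in> S. F y = F x}))"
proof -
  have "(\<Sum>x\<in>S. 1 / real (card {y \<in> S. F y = F x}))
      = (\<Sum>z\<in>F ` S. \<Sum>x\<in>{x \<in> S. F x = z}. 1 / real (card {y \<in> S. F y = F x}))"
    using assms by (rule sum.image_gen)
  also have "\<dots> = (\<Sum>z\<in>F ` S. 1)"
  proof (rule sum.cong[OF refl])
    fix z assume z: "z \<in> F ` S"
    have "(\<Sum>x\<in>{x \<in> S. F x = z}. 1 / real (card {y \<in> S. F y = F x}))
        = (\<Sum>x\<in>{x \<in> S. F x = z}. 1 / real (card {y \<in> S. F y = z}))"
      by (rule sum.cong) auto
    also have "\<dots> = 1"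
      using z assms by (auto simp: card_eq_0_iff)
    finally show "(\<Sum>x\<in>{x \<in> S. F x = z}. 1 / real (card {y \<in> S. F y = F x})) = 1" .
  qed
  finally show ?thesis by simp
qed

context uniform_interpretation
begin

definition lifts :: "('b, 'g, 's) struct \<Rightarrow> 'b list set \<Rightarrow> nat \<Rightarrow> 'a list list set" where
  "lifts N A n = {as \<in> nlists n (dm N). \<exists>a\<in>A. map (h N) a = map (cls N) as}"

lemma finite_dm: "N \<in> C' \<Longrightarrow> finite (dm N)"
  using finite_subset[OF dom_subset finite_nlists] finite_C \<alpha>_in by (auto simp: finite_class_def)

text \<open>The formula \<open>same_class_formula\<close>, seen as a formula whose solutions form the class of its
  parameter tuple.\<close>

lemma class_formula:
  obtains E where "E \<in> formulas L (n * d + (n * d + p))"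
    and "\<And>N as. N \<in> C' \<Longrightarrow> as \<in> nlists n (dm N) \<Longrightarrow>
      def_set (\<alpha> N) E (n * d) (concat as @ c N) =
        concat ` {as' \<in> nlists n (dm N). map (cls N) as' = map (cls N) as}"
proof -
  obtain E where "same_class_formula n E"
    using ex_same_class_formula by blast
  note E = same_class_formulaD(1)[OF this] and E_iff = same_class_formulaD(2)[OF this]
  show thesis
  proof (rule that[OF E])
    fix N as assume N: "N \<in> C'" and as: "as \<in> nlists n (dm N)"
    note as_univ = subsetD[OF nlists_dom_subset as]
    show "def_set (\<alpha> N) E (n * d) (concat as @ c N) =
        concat ` {as' \<in> nlists n (dm N). map (cls N) as' = map (cls N) as}" (is "?D = ?R")
    proof (intro equalityI subsetI)
      fix zs assume "zs \<in> ?D"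
      then have zs: "zs \<in> nlists (n * d) (univ (\<alpha> N))" "holds (\<alpha> N) E (zs @ concat as @ c N)"
        by (auto simp: def_set_def)
      from zs(1) obtain as' where as': "as' \<in> nlists n (nlists d (univ (\<alpha> N)))" "zs = concat as'"
        by (rule nlists_concat_cases)
      with zs(2) E_iff[OF N as'(1) as_univ] show "zs \<in> ?R" by simp
    next
      fix zs assume "zs \<in> ?R"
      then obtain as' where as': "as' \<in> nlists n (dm N)" "map (cls N) as' = map (cls N) as" "zs = concat as'"
        by auto
      with E_iff[OF N subsetD[OF nlists_dom_subset as'(1)] as_univ] as concat_dom_in[OF as'(1)]
      show "zs \<in> ?D" by (simp add: def_set_def)
    qed
  qed
qed

lemma solution_formula:
  assumes \<phi>: "\<phi> \<in> formulas L' (n + m)"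
  obtains \<phi>' where "\<phi>' \<in> formulas L (n * d + (m * d + p))"
    and "\<And>N b bs. N \<in> C' \<Longrightarrow> b \<in> nlists m (univ N) \<Longrightarrow> bs \<in> nlists m (dm N) \<Longrightarrow>
      map (h N) b = map (cls N) bs \<Longrightarrow>
      def_set (\<alpha> N) \<phi>' (n * d) (concat bs @ c N) = concat ` lifts N (def_set N \<phi> n b) n"
proof -
  obtain \<psi> where \<psi>: "\<psi> \<in> formulas L ((n + m) * d + p)"
    and \<psi>_iff: "\<And>N bs as. N \<in> C' \<Longrightarrow> bs \<in> nlists (n + m) (univ N) \<Longrightarrow> as \<in> nlists (n + m) (dm N) \<Longrightarrow>
      map (h N) bs = map (cls N) as \<Longrightarrow> holds N \<phi> bs \<longleftrightarrow> holds (\<alpha> N) \<psi> (concat as @ c N)"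
    using \<phi> by (rule translation) blast
  obtain E where "same_class_formula n E"
    using ex_same_class_formula by blast
  note E = same_class_formulaD(1)[OF this] and E_iff = same_class_formulaD(2)[OF this]
  let ?k = "n * d + (m * d + p)"
  let ?x = "[0..<0 + n * d]" and ?w = "[n * d + m * d..<n * d + m * d + p]"
  have "definable L C ?k (\<lambda>M zs. holds M \<psi> zs \<and> holds M E (map ((!) zs) (?x @ ?x @ ?w)))"
  proof (intro defin.conj defin_subst defin.holds_formula)
    show "\<psi> \<in> formulas L ?k" using \<psi> by (simp add: algebra_simps)
    show "?x @ ?x @ ?w \<in> nlists (n * d + (n * d + p)) {..<?k}"
      by (intro nlists_appendI segment_in_nlists; simp)
  qed (rule E)
  then obtain \<phi>' where \<phi>': "\<phi>' \<in> formulas L ?k"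
    and \<phi>'_iff: "\<And>M zs. M \<in> C \<Longrightarrow> zs \<in> nlists ?k (univ M) \<Longrightarrow>
      holds M \<phi>' zs \<longleftrightarrow> holds M \<psi> zs \<and> holds M E (map ((!) zs) (?x @ ?x @ ?w))"
    unfolding definable_def by blast
  show thesis
  proof (rule that[OF \<phi>'])
    fix N b bs
    assume N: "N \<in> C'" and b: "b \<in> nlists m (univ N)" and bs: "bs \<in> nlists m (dm N)"
      and eq: "map (h N) b = map (cls N) bs"
    have holds_iff: "holds (\<alpha> N) \<phi>' (concat as @ concat bs @ c N) \<longleftrightarrow> as \<in> lifts N (def_set N \<phi> n b) n"
      if as: "as \<in> nlists n (nlists d (univ (\<alpha> N)))" for as
    proof -
      let ?zs = "concat as @ concat bs @ c N"
      have "?zs \<in> nlists ?k (univ (\<alpha> N))"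
        by (intro nlists_appendI concat_nlists[OF as] concat_dom_in[OF bs] par_in[OF N])
      moreover have "map ((!) ?zs) ?x = concat as" "map ((!) ?zs) ?w = c N"
        using length_concat_nlists[OF as] length_concat_dom[OF bs] nlistsE_length[OF par_in[OF N]]
        by (subst map_nth_segment; simp)+
      ultimately have "holds (\<alpha> N) \<phi>' ?zs \<longleftrightarrow>
          holds (\<alpha> N) \<psi> ?zs \<and> holds (\<alpha> N) E (concat as @ concat as @ c N)"
        using \<phi>'_iff[OF \<alpha>_in[OF N]] by simp
      also have "\<dots> \<longleftrightarrow> holds (\<alpha> N) \<psi> ?zs \<and> as \<in> nlists n (dm N)"
        using E_iff[OF N as as] by simp
      also have "\<dots> \<longleftrightarrow> as \<in> lifts N (def_set N \<phi> n b) n"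
      proof (cases "as \<in> nlists n (dm N)")
        case True
        have \<psi>': "holds (\<alpha> N) \<psi> ?zs \<longleftrightarrow> holds N \<phi> (a @ b)"
          if a: "a \<in> nlists n (univ N)" "map (h N) a = map (cls N) as" for a
          using \<psi>_iff[OF N nlists_appendI[OF a(1) b] nlists_appendI[OF True bs]] a(2) eq by simp
        obtain a where "a \<in> nlists n (univ N)" "map (h N) a = map (cls N) as"
          using N True by (rule obtain_elements)
        with True \<psi>' show ?thesis
          unfolding lifts_def def_set_def by blast
      qed (simp add: lifts_def)
      finally show ?thesis .
    qed
    show "def_set (\<alpha> N) \<phi>' (n * d) (concat bs @ c N) = concat ` lifts N (def_set N \<phi> n b) n" (is "?D = ?R")
    proof (intro equalityI subsetI)
      fix zs assume "zs \<in> ?D"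
      then have zs: "zs \<in> nlists (n * d) (univ (\<alpha> N))" "holds (\<alpha> N) \<phi>' (zs @ concat bs @ c N)"
        by (auto simp: def_set_def)
      from zs(1) obtain as where as: "as \<in> nlists n (nlists d (univ (\<alpha> N)))" "zs = concat as"
        by (rule nlists_concat_cases)
      with zs(2) holds_iff show "zs \<in> ?R" by simp
    next
      fix zs assume "zs \<in> ?R"
      then obtain as where as: "as \<in> lifts N (def_set N \<phi> n b) n" "zs = concat as" by auto
      then have "as \<in> nlists n (dm N)" by (simp add: lifts_def)
      with as holds_iff[OF subsetD[OF nlists_dom_subset]] show "zs \<in> ?D"
        by (simp add: def_set_def concat_dom_in)
    qed
  qed
qed

lemma card_eq_card_classes:
  assumes N: "N \<in> C'" and A: "A \<subseteq> nlists n (univ N)"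
  shows "card A = card (map (cls N) ` lifts N A n)"
proof -
  have "map (cls N) ` lifts N A n = map (h N) ` A"
  proof (intro equalityI subsetI)
    fix z assume "z \<in> map (cls N) ` lifts N A n"
    then obtain as a where "z = map (cls N) as" "a \<in> A" "map (h N) a = map (cls N) as"
      by (auto simp: lifts_def)
    then show "z \<in> map (h N) ` A" by (metis imageI)
  next
    fix z assume "z \<in> map (h N) ` A"
    then obtain a where a: "a \<in> A" "z = map (h N) a" by auto
    obtain as where "as \<in> nlists n (dm N)" "map (h N) a = map (cls N) as"
      using obtain_representatives[OF N subsetD[OF A a(1)]] .
    with a show "z \<in> map (cls N) ` lifts N A n" by (auto simp: lifts_def)
  qed
  moreover have "inj_on (map (h N)) A"
    using inj_on_map_nlists[OF inj_h[OF N]] A by (rule inj_on_subset)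
  ultimately show ?thesis by (simp add: card_image)
qed

lemma inj_on_concat_dm: "A \<subseteq> nlists n (dm N) \<Longrightarrow> inj_on concat A"
  using inj_on_concat_nlists nlists_dom_subset by (metis inj_on_subset)

text \<open>The number of solutions of \<open>\<phi>\<close> as a sum of reciprocals of class sizes, where \<open>\<phi>'\<close> defines the
  tuples that represent a solution and \<open>E\<close> the class of a tuple. The second conjunct keeps the class
  sizes in the denominators from being 0; the third is the case of singleton classes.\<close>

definition counting_formulas ::
  "nat \<Rightarrow> nat \<Rightarrow> ('g, 's) fm \<Rightarrow> ('f, 'r) fm \<Rightarrow> ('f, 'r) fm \<Rightarrow> bool" where
  "counting_formulas n m \<phi> \<phi>' E \<longleftrightarrow>
     \<phi>' \<in> formulas L (n * d + (m * d + p)) \<and> E \<in> formulas L (n * d + (n * d + p)) \<and>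
     (\<forall>N b bs. N \<in> C' \<longrightarrow> b \<in> nlists m (univ N) \<longrightarrow> bs \<in> nlists m (dm N) \<longrightarrow>
        map (h N) b = map (cls N) bs \<longrightarrow>
        real (card (def_set N \<phi> n b)) =
          (\<Sum>x\<in>def_set (\<alpha> N) \<phi>' (n * d) (concat bs @ c N).
             1 / real (card (def_set (\<alpha> N) E (n * d) (x @ c N)))) \<and>
        (\<forall>x\<in>def_set (\<alpha> N) \<phi>' (n * d) (concat bs @ c N). x \<in> def_set (\<alpha> N) E (n * d) (x @ c N)) \<and>
        (ieq I (\<alpha> N) (c N) = Id_on (dm N) \<longrightarrow>
           card (def_set N \<phi> n b) = card (def_set (\<alpha> N) \<phi>' (n * d) (concat bs @ c N))))"

lemma counting_formulasD:
  assumes "counting_formulas n m \<phi> \<phi>' E"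
  shows "\<phi>' \<in> formulas L (n * d + (m * d + p))" and "E \<in> formulas L (n * d + (n * d + p))"
    and "\<And>N b bs. N \<in> C' \<Longrightarrow> b \<in> nlists m (univ N) \<Longrightarrow> bs \<in> nlists m (dm N) \<Longrightarrow>
      map (h N) b = map (cls N) bs \<Longrightarrow>
      real (card (def_set N \<phi> n b)) =
        (\<Sum>x\<in>def_set (\<alpha> N) \<phi>' (n * d) (concat bs @ c N).
           1 / real (card (def_set (\<alpha> N) E (n * d) (x @ c N))))"
    and "\<And>N b bs. N \<in> C' \<Longrightarrow> b \<in> nlists m (univ N) \<Longrightarrow> bs \<in> nlists m (dm N) \<Longrightarrow>
      map (h N) b = map (cls N) bs \<Longrightarrow>
      \<forall>x\<in>def_set (\<alpha> N) \<phi>' (n * d) (concat bs @ c N). x \<in> def_set (\<alpha> N) E (n * d) (x @ c N)"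
    and "\<And>N b bs. N \<in> C' \<Longrightarrow> b \<in> nlists m (univ N) \<Longrightarrow> bs \<in> nlists m (dm N) \<Longrightarrow>
      map (h N) b = map (cls N) bs \<Longrightarrow> ieq I (\<alpha> N) (c N) = Id_on (dm N) \<Longrightarrow>
      card (def_set N \<phi> n b) = card (def_set (\<alpha> N) \<phi>' (n * d) (concat bs @ c N))"
  using assms unfolding counting_formulas_def by blast+

theorem ex_counting_formulas:
  assumes \<phi>: "\<phi> \<in> formulas L' (n + m)"
  shows "\<exists>\<phi>' E. counting_formulas n m \<phi> \<phi>' E"
proof -
  obtain \<phi>' where \<phi>': "\<phi>' \<in> formulas L (n * d + (m * d + p))"
    and \<phi>'_set: "\<And>N b bs. N \<in> C' \<Longrightarrow> b \<in> nlists m (univ N) \<Longrightarrow> bs \<in> nlists m (dm N) \<Longrightarrow>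
      map (h N) b = map (cls N) bs \<Longrightarrow>
      def_set (\<alpha> N) \<phi>' (n * d) (concat bs @ c N) = concat ` lifts N (def_set N \<phi> n b) n"
    using \<phi> by (rule solution_formula) blast
  obtain E where E: "E \<in> formulas L (n * d + (n * d + p))"
    and E_set: "\<And>N as. N \<in> C' \<Longrightarrow> as \<in> nlists n (dm N) \<Longrightarrow>
      def_set (\<alpha> N) E (n * d) (concat as @ c N) =
        concat ` {as' \<in> nlists n (dm N). map (cls N) as' = map (cls N) as}"
    by (rule class_formula) blast
  have "counting_formulas n m \<phi> \<phi>' E"
    unfolding counting_formulas_def
  proof (intro conjI \<phi>' E allI impI)
    fix N b bs
    assume N: "N \<in> C'" and b: "b \<in> nlists m (univ N)" and bs: "bs \<in> nlists m (dm N)"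
      and eq: "map (h N) b = map (cls N) bs"
    let ?A = "def_set N \<phi> n b" and ?D = "def_set (\<alpha> N) \<phi>' (n * d) (concat bs @ c N)"
    let ?S = "lifts N ?A n" and ?F = "map (cls N)"
    have D: "?D = concat ` ?S" using N b bs eq by (rule \<phi>'_set)
    have A: "?A \<subseteq> nlists n (univ N)" by (auto simp: def_set_def)
    have S: "?S \<subseteq> nlists n (dm N)" by (auto simp: lifts_def)
    then have finite_S: "finite ?S"
      using finite_nlists[OF finite_dm[OF N]] by (rule finite_subset)
    \<comment> \<open>The set defined by \<open>\<phi>'\<close> is a union of classes, so classes taken inside it are complete.\<close>
    have E_card: "card (def_set (\<alpha> N) E (n * d) (concat as @ c N)) = card {as' \<in> ?S. ?F as' = ?F as}"
      if as: "as \<in> ?S" for as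
    proof -
      have "{as' \<in> nlists n (dm N). ?F as' = ?F as} = {as' \<in> ?S. ?F as' = ?F as}"
        using as by (auto simp: lifts_def)
      then have "def_set (\<alpha> N) E (n * d) (concat as @ c N) = concat ` {as' \<in> ?S. ?F as' = ?F as}"
        using E_set[OF N subsetD[OF S as]] by simp
      moreover have "inj_on concat {as' \<in> ?S. ?F as' = ?F as}"
        using S by (intro inj_on_concat_dm) auto
      ultimately show ?thesis by (simp add: card_image)
    qed
    have "real (card ?A) = (\<Sum>as\<in>?S. 1 / real (card {as' \<in> ?S. ?F as' = ?F as}))"
      unfolding card_eq_card_classes[OF N A] using finite_S by (rule card_image_eq_sum_fibres)
    also have "\<dots> = (\<Sum>as\<in>?S. 1 / real (card (def_set (\<alpha> N) E (n * d) (concat as @ c N))))"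
      by (simp add: E_card)
    also have "\<dots> = (\<Sum>x\<in>?D. 1 / real (card (def_set (\<alpha> N) E (n * d) (x @ c N))))"
      unfolding D by (simp add: sum.reindex[OF inj_on_concat_dm[OF S]])
    finally show "real (card ?A) = (\<Sum>x\<in>?D. 1 / real (card (def_set (\<alpha> N) E (n * d) (x @ c N))))" .
    show "\<forall>x\<in>?D. x \<in> def_set (\<alpha> N) E (n * d) (x @ c N)"
      unfolding D using S E_set[OF N] by auto
    assume Id: "ieq I (\<alpha> N) (c N) = Id_on (dm N)"
    then have "cls N x = {x}" if "x \<in> dm N" for x
      using that by (auto simp: icls_def)
    then have "inj_on (cls N) (dm N)"
      by (intro inj_onI) simp
    then have "inj_on ?F ?S"
      using inj_on_map_nlists S by (metis inj_on_subset)
    then show "card ?A = card ?D"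
      unfolding D card_eq_card_classes[OF N A] by (simp add: card_image inj_on_concat_dm[OF S])
  qed
  then show ?thesis by blast
qed

lemma card_univ_le: "N \<in> C' \<Longrightarrow> card (univ N) \<le> card (univ (\<alpha> N)) ^ d"
proof -
  assume N: "N \<in> C'"
  then have fin: "finite (univ (\<alpha> N))" using finite_C \<alpha>_in by (auto simp: finite_class_def)
  have "card (univ N) = card (cls N ` dm N)"
    using card_image[OF inj_h[OF N]] h_image[OF N] by simp
  also have "\<dots> \<le> card (dm N)" by (rule card_image_le[OF finite_dm[OF N]])
  also have "\<dots> \<le> card (nlists d (univ (\<alpha> N)))"
    by (rule card_mono[OF finite_nlists[OF fin] dom_subset])
  finally show ?thesis by (simp add: card_nlists[OF fin])
qed

end

section \<open>Approximate and exact sizes\<close>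

text \<open>With all positive errors in \<open>T\<close> and all thresholds in \<open>Q\<close> this is \<open>asymp_size\<close>; with
  \<open>T = {0}\<close> and \<open>Q = {0}\<close> it is \<open>exact_size\<close>.\<close>

definition size_close ::
  "real set \<Rightarrow> nat set \<Rightarrow> ('f, 'r) fm \<Rightarrow> nat \<Rightarrow> (('a, 'f, 'r) struct \<times> 'a list) set
    \<Rightarrow> (('a, 'f, 'r) struct \<Rightarrow> real) \<Rightarrow> bool" where
  "size_close T Q \<phi> n r s \<longleftrightarrow> (\<forall>\<epsilon>\<in>T. \<exists>K\<in>Q. \<forall>(M, b)\<in>r. K \<le> card (univ M) \<longrightarrow>
     \<bar>real (card (def_set M \<phi> n b)) - s M\<bar> \<le> \<epsilon> * s M)"

lemma asymp_size_iff: "asymp_size \<phi> n r s \<longleftrightarrow> size_close {0<..} UNIV \<phi> n r s"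
proof
  assume *: "asymp_size \<phi> n r s"
  show "size_close {0<..} UNIV \<phi> n r s"
    unfolding size_close_def
  proof
    fix \<epsilon> :: real assume "\<epsilon> \<in> {0<..}"
    then obtain K where "\<forall>(M, b)\<in>r. card (univ M) > K \<longrightarrow> \<bar>real (card (def_set M \<phi> n b)) - s M\<bar> \<le> \<epsilon> * s M"
      using * unfolding asymp_size_def by auto
    then show "\<exists>K\<in>UNIV. \<forall>(M, b)\<in>r. K \<le> card (univ M) \<longrightarrow> \<bar>real (card (def_set M \<phi> n b)) - s M\<bar> \<le> \<epsilon> * s M"
      by (intro bexI[of _ "Suc K"]) auto
  qed
next
  assume *: "size_close {0<..} UNIV \<phi> n r s"
  show "asymp_size \<phi> n r s"
    unfolding asymp_size_def
  proof (intro allI impI)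
    fix \<epsilon> :: real assume "\<epsilon> > 0"
    then obtain K where "\<forall>(M, b)\<in>r. K \<le> card (univ M) \<longrightarrow> \<bar>real (card (def_set M \<phi> n b)) - s M\<bar> \<le> \<epsilon> * s M"
      using * unfolding size_close_def by auto
    then show "\<exists>K. \<forall>(M, b)\<in>r. K < card (univ M) \<longrightarrow> \<bar>real (card (def_set M \<phi> n b)) - s M\<bar> \<le> \<epsilon> * s M"
      by (intro exI[of _ K]) auto
  qed
qed

lemma exact_size_iff: "exact_size \<phi> n r s \<longleftrightarrow> size_close {0} {0} \<phi> n r s"
  by (auto simp: exact_size_def size_close_def)

lemma size_close_subset: "size_close T Q \<phi> n r s \<Longrightarrow> r' \<subseteq> r \<Longrightarrow> size_close T Q \<phi> n r' s"
  unfolding size_close_def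
proof (intro ballI)
  fix \<epsilon>
  assume "\<forall>\<epsilon>\<in>T. \<exists>K\<in>Q. \<forall>(M, b)\<in>r. K \<le> card (univ M) \<longrightarrow>
      \<bar>real (card (def_set M \<phi> n b)) - s M\<bar> \<le> \<epsilon> * s M" and "\<epsilon> \<in> T" and "r' \<subseteq> r"
  then obtain K where "K \<in> Q" "\<forall>(M, b)\<in>r. K \<le> card (univ M) \<longrightarrow>
      \<bar>real (card (def_set M \<phi> n b)) - s M\<bar> \<le> \<epsilon> * s M" by auto
  with \<open>r' \<subseteq> r\<close> show "\<exists>K\<in>Q. \<forall>(M, b)\<in>r'. K \<le> card (univ M) \<longrightarrow>
      \<bar>real (card (def_set M \<phi> n b)) - s M\<bar> \<le> \<epsilon> * s M" by (intro bexI[of _ K]) auto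
qed

text \<open>What the transfer needs of \<open>T\<close> and \<open>Q\<close>. Numerators and denominators with relative error
  \<open>\<epsilon> / (2 + \<epsilon>)\<close> give quotients with relative error \<open>\<epsilon>\<close>. A structure interpreted on \<open>d\<close>-tuples of a
  structure with fewer than \<open>K\<close> elements has fewer than \<open>K * (K ^ d + 1)\<close> elements; unlike \<open>K ^ d + 1\<close>,
  this threshold is 0 for \<open>K = 0\<close>, as the exact case requires.\<close>

definition precision :: "real set \<Rightarrow> nat set \<Rightarrow> bool" where
  "precision T Q \<longleftrightarrow> (\<forall>\<epsilon>\<in>T. 0 \<le> \<epsilon> \<and> \<epsilon> / (2 + \<epsilon>) \<in> T) \<and>
     0 \<in> Q \<and> (\<forall>K\<in>Q. \<forall>K'\<in>Q. max K K' \<in> Q) \<and> (\<forall>K\<in>Q. \<forall>d. K * (K ^ d + 1) \<in> Q)"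

lemma precision_asymp: "precision {0<..} UNIV"
  by (simp add: precision_def)

lemma precision_exact: "precision {0} {0}"
  by (simp add: precision_def)

lemma common_threshold:
  assumes "precision T Q" "finite F" "\<And>q. q \<in> F \<Longrightarrow> \<exists>K\<in>Q. \<forall>k\<ge>K. P q k"
  shows "\<exists>K\<in>Q. \<forall>q\<in>F. \<forall>k\<ge>K. P q k"
  using assms(2,3)
proof (induction F)
  case empty
  then show ?case using assms(1) by (auto simp: precision_def)
next
  case (insert q F)
  obtain K where "K \<in> Q" "\<forall>q\<in>F. \<forall>k\<ge>K. P q k" using insert by auto
  moreover obtain K' where "K' \<in> Q" "\<forall>k\<ge>K'. P q k" using insert.prems by auto
  ultimately show ?case
    using assms(1) by (intro bexI[of _ "max K K'"]) (auto simp: precision_def)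
qed

text \<open>With \<open>\<delta> = \<epsilon> / (2 + \<epsilon>)\<close> the sum is at most \<open>(1 + \<delta>) g / ((1 - \<delta>) h) = (1 + \<epsilon>) g / h\<close>, and at
  least \<open>g / ((1 + \<epsilon>) h)\<close>, which is no less than \<open>(1 - \<epsilon>) g / h\<close>. If \<open>D\<close> is empty then \<open>g = 0\<close>, since
  \<open>\<delta> < 1\<close>, and so \<open>h = 0\<close> is harmless.\<close>

lemma sum_reciprocals_close:
  fixes e :: "'x \<Rightarrow> real"
  assumes "0 \<le> \<epsilon>" "finite D" and e: "\<And>x. x \<in> D \<Longrightarrow> 0 < e x \<and> \<bar>e x - h\<bar> \<le> \<epsilon> / (2 + \<epsilon>) * h"
    and g: "\<bar>real (card D) - g\<bar> \<le> \<epsilon> / (2 + \<epsilon>) * g"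
  shows "\<bar>(\<Sum>x\<in>D. 1 / e x) - g / h\<bar> \<le> \<epsilon> * (g / h)"
proof -
  define \<delta> where "\<delta> = \<epsilon> / (2 + \<epsilon>)"
  have \<delta>: "0 \<le> \<delta>" "\<delta> < 1" "1 + \<delta> = (1 + \<epsilon>) * (1 - \<delta>)"
    using \<open>0 \<le> \<epsilon>\<close> by (auto simp: \<delta>_def field_simps)
  have g': "(1 - \<delta>) * g \<le> real (card D)" "real (card D) \<le> (1 + \<delta>) * g"
    using g unfolding \<delta>_def[symmetric] by (auto simp: abs_le_iff algebra_simps)
  have "0 \<le> (1 + \<delta>) * g" using g'(2) by (rule order_trans[rotated]) simp
  then have g_nonneg: "0 \<le> g" using \<delta> by (simp add: zero_le_mult_iff)
  show ?thesis
  proof (cases "D = {}")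
    case True
    then have "g \<le> 0" using g'(1) \<delta> by (simp add: mult_le_0_iff)
    with True g_nonneg show ?thesis by simp
  next
    case False
    then obtain x where "x \<in> D" by auto
    have e': "0 < e x" "(1 - \<delta>) * h \<le> e x" "e x \<le> (1 + \<delta>) * h" if "x \<in> D" for x
      using e[OF that] unfolding \<delta>_def[symmetric] by (auto simp: abs_le_iff algebra_simps)
    have "0 < (1 + \<delta>) * h" using e'(1,3)[OF \<open>x \<in> D\<close>] by linarith
    then have h: "0 < h" using \<delta> by (simp add: zero_less_mult_iff)
    have pos: "0 < (1 - \<delta>) * h" "0 < (1 + \<delta>) * h" using h \<delta> by simp_all
    have "(\<Sum>x\<in>D. 1 / e x) \<le> real (card D) * (1 / ((1 - \<delta>) * h))"
      using e' pos h \<delta> by (intro sum_bounded_above divide_left_mono mult_pos_pos) auto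
    also have "\<dots> \<le> (1 + \<delta>) * g * (1 / ((1 - \<delta>) * h))"
      using g'(2) pos by (intro mult_right_mono) simp_all
    also have "\<dots> = (1 + \<epsilon>) * (g / h)"
      unfolding \<delta>(3) using \<delta>(1,2) by simp
    finally have upper: "(\<Sum>x\<in>D. 1 / e x) \<le> (1 + \<epsilon>) * (g / h)" .
    have "(1 - \<epsilon>) * (1 + \<epsilon>) \<le> 1" by (simp add: algebra_simps)
    then have "(1 - \<epsilon>) * (g / h) \<le> 1 / (1 + \<epsilon>) * (g / h)"
      using \<open>0 \<le> \<epsilon>\<close> g_nonneg h by (intro mult_right_mono) (simp_all add: field_simps)
    also have "\<dots> = (1 - \<delta>) * g * (1 / ((1 + \<delta>) * h))"
      unfolding \<delta>(3) using \<delta> h \<open>0 \<le> \<epsilon>\<close> by simp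
    also have "\<dots> \<le> real (card D) * (1 / ((1 + \<delta>) * h))"
      using g'(1) pos by (intro mult_right_mono) simp_all
    also have "\<dots> \<le> (\<Sum>x\<in>D. 1 / e x)"
      using e' pos h \<delta> by (intro sum_bounded_below divide_left_mono mult_pos_pos) auto
    finally have lower: "(1 - \<epsilon>) * (g / h) \<le> (\<Sum>x\<in>D. 1 / e x)" .
    show ?thesis
      using lower upper unfolding abs_le_iff left_diff_distrib distrib_right by linarith
  qed
qed

section \<open>Classes with controlled sizes\<close>

definition sized_class ::
  "real set \<Rightarrow> nat set \<Rightarrow> bool \<Rightarrow> ('f, 'r) lang \<Rightarrow> (('a, 'f, 'r) struct \<Rightarrow> real) set
    \<Rightarrow> ('a, 'f, 'r) struct set \<Rightarrow> bool" where
  "sized_class T Q strong L R C \<longleftrightarrow>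
     (\<forall>n m. \<forall>\<phi>\<in>formulas L (n + m). \<exists>P s. finite P \<and> partition_on (pointed C m) P \<and>
        (strong \<longrightarrow> definable_partition L C m P) \<and>
        (\<forall>r\<in>P. s r \<in> R \<and> size_close T Q \<phi> n r (s r)))"

lemma sized_class_iffs:
  "weak_mac L R C \<longleftrightarrow> sized_class {0<..} UNIV False L R C"
  "mac L R C \<longleftrightarrow> sized_class {0<..} UNIV True L R C"
  "weak_mec L R C \<longleftrightarrow> sized_class {0} {0} False L R C"
  "mec L R C \<longleftrightarrow> sized_class {0} {0} True L R C"
  by (simp_all add: weak_mac_def mac_def weak_mec_def mec_def sized_class_def
      asymp_size_iff exact_size_iff)

lemma sized_classE:
  assumes sized: "sized_class T Q strong L R C" and \<phi>: "\<phi> \<in> formulas L (n + m)"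
  obtains P s where "finite P" "partition_on (pointed C m) P" "strong \<longrightarrow> definable_partition L C m P"
    "\<forall>r\<in>P. s r \<in> R \<and> size_close T Q \<phi> n r (s r)"
  using sized[unfolded sized_class_def, THEN spec, THEN spec, THEN bspec, OF \<phi>]
  by (elim exE conjE) (rule that)

lemma definable_partition_iff:
  fixes C :: "('a, 'f, 'r) struct set"
  shows "definable_partition L C m P \<longleftrightarrow> (\<forall>r\<in>P. definable L C m (\<lambda>M b. (M, b) \<in> r))"
proof -
  have "def_set M \<psi> m [] = {b \<in> nlists m (univ M). (M, b) \<in> r} \<longleftrightarrow>
      (\<forall>b\<in>nlists m (univ M). holds M \<psi> b \<longleftrightarrow> (M, b) \<in> r)"
    for M :: "('a, 'f, 'r) struct" and \<psi> r
    by (auto simp: def_set_def)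
  then show ?thesis
    by (simp add: definable_partition_def definable_def)
qed

lemma partition_on_refine:
  assumes P: "partition_on A P" and P': "partition_on A P'"
  shows "partition_on A ({r \<inter> r' |r r'. r \<in> P \<and> r' \<in> P'} - {{}})"
proof (rule partition_onI)
  show "\<Union> ({r \<inter> r' |r r'. r \<in> P \<and> r' \<in> P'} - {{}}) = A"
    using partition_onD1[OF P] partition_onD1[OF P'] by blast
  fix u v assume "u \<in> {r \<inter> r' |r r'. r \<in> P \<and> r' \<in> P'} - {{}}"
    "v \<in> {r \<inter> r' |r r'. r \<in> P \<and> r' \<in> P'} - {{}}" "u \<noteq> v"
  then obtain r r' t t' where uv: "u = r \<inter> r'" "v = t \<inter> t'" "r \<in> P" "r' \<in> P'" "t \<in> P" "t' \<in> P'"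
    "r \<noteq> t \<or> r' \<noteq> t'" by blast
  then have "r \<inter> t = {} \<or> r' \<inter> t' = {}"
    using disjointD[OF partition_onD2[OF P]] disjointD[OF partition_onD2[OF P']] by blast
  with uv show "disjnt u v" unfolding disjnt_def by blast
qed simp

text \<open>Finitely many formulas can share one partition: intersect the pieces of their partitions.
  The estimates pass to smaller pieces.\<close>

lemma sized_class_common_partition:
  assumes C: "\<And>M. M \<in> C \<Longrightarrow> is_struct L M" and sized: "sized_class T Q strong L R C"
    and "finite F" "\<And>q. q \<in> F \<Longrightarrow> \<phi> q \<in> formulas L (n + m)"
  shows "\<exists>P s. finite P \<and> partition_on (pointed C m) P \<and> (strong \<longrightarrow> definable_partition L C m P) \<and>
    (\<forall>r\<in>P. \<forall>q\<in>F. s r q \<in> R \<and> size_close T Q (\<phi> q) n r (s r q))"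
  using assms(3,4)
proof (induction F)
  interpret relation_system L C "definable L C"
    using C by (rule definable_relation_system)
  case empty
  show ?case
  proof (intro exI conjI impI)
    show "partition_on (pointed C m) ({pointed C m} - {{}})"
      by (cases "pointed C m = {}") (simp_all add: partition_on_empty partition_on_space)
    have "definable L C m (\<lambda>M b. (M, b) \<in> pointed C m)"
      by (rule cong[OF true]) (simp add: pointed_def)
    then show "definable_partition L C m ({pointed C m} - {{}})"
      by (simp add: definable_partition_iff)
  qed simp_all
next
  interpret relation_system L C "definable L C"
    using C by (rule definable_relation_system)
  case (insert q F)
  obtain P s where P: "finite P" "partition_on (pointed C m) P" "strong \<longrightarrow> definable_partition L C m P"
    "\<forall>r\<in>P. \<forall>q\<in>F. s r q \<in> R \<and> size_close T Q (\<phi> q) n r (s r q)"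
    using insert.IH insert.prems by auto
  obtain P' s' where P': "finite P'" "partition_on (pointed C m) P'" "strong \<longrightarrow> definable_partition L C m P'"
    "\<forall>r\<in>P'. s' r \<in> R \<and> size_close T Q (\<phi> q) n r (s' r)"
    using sized insert.prems[of q] unfolding sized_class_def by blast
  let ?P = "{r \<inter> r' |r r'. r \<in> P \<and> r' \<in> P'} - {{}}"
  have "\<forall>u\<in>?P. \<exists>w. fst w \<in> P \<and> snd w \<in> P' \<and> u = fst w \<inter> snd w" by auto
  from bchoice[OF this] obtain w
    where "\<forall>u\<in>?P. fst (w u) \<in> P \<and> snd (w u) \<in> P' \<and> u = fst (w u) \<inter> snd (w u)"
    by (rule exE)
  note w = bspec[OF this]
  have "?P \<subseteq> (\<lambda>(r, r'). r \<inter> r') ` (P \<times> P')" by auto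
  then have "finite ?P"
    by (rule finite_subset) (intro finite_imageI finite_cartesian_product P(1) P'(1))
  moreover have "definable_partition L C m ?P" if strong
  proof -
    have "definable L C m (\<lambda>M b. (M, b) \<in> r \<inter> r')" if "r \<in> P" "r' \<in> P'" for r r'
      using conj[of m "\<lambda>M b. (M, b) \<in> r" "\<lambda>M b. (M, b) \<in> r'"] P(3) P'(3) \<open>strong\<close> that
      by (simp add: definable_partition_iff)
    then show ?thesis by (auto simp: definable_partition_iff)
  qed
  moreover have "(if q' = q then s' (snd (w u)) else s (fst (w u)) q') \<in> R \<and>
      size_close T Q (\<phi> q') n u (if q' = q then s' (snd (w u)) else s (fst (w u)) q')"
    if u: "u \<in> ?P" and q': "q' \<in> insert q F" for u q'
  proof -
    have sub: "u \<subseteq> fst (w u)" "u \<subseteq> snd (w u)" using w[OF u] by auto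
    show ?thesis
      using w[OF u] P(4) P'(4) q' size_close_subset[OF _ sub(1)] size_close_subset[OF _ sub(2)]
      by (cases "q' = q") auto
  qed
  ultimately show ?case
    using partition_on_refine[OF P(2) P'(2)]
    by (intro exI[of _ ?P] exI[of _ "\<lambda>u q'. if q' = q then s' (snd (w u)) else s (fst (w u)) q'"]
        conjI ballI impI) simp_all
qed

lemma Frac_sum:
  assumes "finite F" "F \<noteq> {}" "\<And>q. q \<in> F \<Longrightarrow> g q \<in> R \<and> h q \<in> R"
  shows "(\<lambda>M. \<Sum>q\<in>F. g q M / h q M) \<in> Frac R"
proof -
  obtain k where k: "bij_betw k {1..card F} F"
    using ex_bij_betw_nat_finite_1[OF assms(1)] by blast
  have "1 \<le> card F" using assms(1,2) by (simp add: Suc_le_eq card_gt_0_iff)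
  moreover have "\<forall>i\<in>{1..card F}. g (k i) \<in> R \<and> h (k i) \<in> R"
    using assms(3) bij_betwE[OF k] by blast
  moreover have "(\<lambda>M. \<Sum>q\<in>F. g q M / h q M) = (\<lambda>M. \<Sum>i=1..card F. g (k i) M / h (k i) M)"
    by (rule ext) (rule sum.reindex_bij_betw[OF k, symmetric])
  ultimately show ?thesis
    unfolding Frac_def
    by (intro CollectI exI[of _ "card F"] conjI exI[of _ "\<lambda>i. g (k i)"] exI[of _ "\<lambda>i. h (k i)"])
qed

section \<open>Transfer along an interpretation\<close>

context uniform_interpretation
begin

text \<open>The tuples over \<open>\<alpha> N\<close> that can replace the parameters \<open>b\<close>: representatives of \<open>b\<close>, followed by the
  parameters of the interpretation.\<close>

definition codes :: "nat \<Rightarrow> ('b, 'g, 's) struct \<Rightarrow> 'b list \<Rightarrow> 'a list set" where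
  "codes m N b = {concat bs @ c N | bs. bs \<in> nlists m (dm N) \<and> map (h N) b = map (cls N) bs}"

lemma codes_pointed:
  assumes "N \<in> C'" "z \<in> codes m N b"
  shows "(\<alpha> N, z) \<in> pointed C (m * d + p)"
  using assms \<alpha>_in by (auto simp: codes_def pointed_def intro!: nlists_appendI concat_dom_in par_in)

lemma ex_code:
  assumes "(N, b) \<in> pointed C' m"
  shows "\<exists>z. z \<in> codes m N b"
proof -
  have "N \<in> C'" "b \<in> nlists m (univ N)" using assms by (auto simp: pointed_def)
  then obtain bs where "bs \<in> nlists m (dm N)" "map (h N) b = map (cls N) bs"
    by (rule obtain_representatives)
  then show ?thesis by (auto simp: codes_def)
qed

text \<open>Which piece of \<open>P\<close> contains a code of \<open>b\<close> may depend on the code. Grouping the pairs \<open>(N, b)\<close> by the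
  set of all pieces that contain one avoids a choice of codes, which could not be expected to be
  definable.\<close>

definition touched ::
  "nat \<Rightarrow> (('a, 'f, 'r) struct \<times> 'a list) set set \<Rightarrow> ('b, 'g, 's) struct \<times> 'b list
    \<Rightarrow> (('a, 'f, 'r) struct \<times> 'a list) set set" where
  "touched m P = (\<lambda>(N, b). {r \<in> P. \<exists>z\<in>codes m N b. (\<alpha> N, z) \<in> r})"

definition pullback_partition ::
  "nat \<Rightarrow> (('a, 'f, 'r) struct \<times> 'a list) set set \<Rightarrow> (('b, 'g, 's) struct \<times> 'b list) set set" where
  "pullback_partition m P =
     (\<lambda>\<tau>. {x \<in> pointed C' m. touched m P x = \<tau>}) ` touched m P ` pointed C' m"

lemma finite_pullback_partition:
  assumes "finite P"
  shows "finite (pullback_partition m P)"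
proof -
  have "touched m P ` pointed C' m \<subseteq> Pow P" by (auto simp: touched_def)
  then have "finite (touched m P ` pointed C' m)"
    using assms by (rule finite_subset[OF _ finite_Pow_iff[THEN iffD2]])
  then show ?thesis
    unfolding pullback_partition_def by (rule finite_imageI)
qed

lemma partition_on_pullback_partition: "partition_on (pointed C' m) (pullback_partition m P)"
  by (rule partition_onI) (auto simp: pullback_partition_def disjnt_def)

lemma pullback_partition_code:
  assumes P: "partition_on (pointed C (m * d + p)) P" and r': "r' \<in> pullback_partition m P"
  obtains r where "r \<in> P"
    and "\<And>N b. (N, b) \<in> r' \<Longrightarrow> (N, b) \<in> pointed C' m \<and> (\<exists>z\<in>codes m N b. (\<alpha> N, z) \<in> r)"
proof -
  from r' obtain N b where Nb: "(N, b) \<in> pointed C' m"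
    and r'_eq: "r' = {x \<in> pointed C' m. touched m P x = touched m P (N, b)}"
    by (auto simp: pullback_partition_def)
  obtain z where z: "z \<in> codes m N b" using ex_code[OF Nb] by auto
  moreover have "N \<in> C'" using Nb by (simp add: pointed_def)
  ultimately have "(\<alpha> N, z) \<in> \<Union> P"
    using codes_pointed partition_onD1[OF P] by blast
  then obtain r where r: "r \<in> P" "(\<alpha> N, z) \<in> r" by auto
  then have "r \<in> touched m P (N, b)" using z by (auto simp: touched_def)
  then have "(N', b') \<in> pointed C' m \<and> (\<exists>z\<in>codes m N' b'. (\<alpha> N', z) \<in> r)" if "(N', b') \<in> r'" for N' b'
    using that unfolding r'_eq by (auto simp: touched_def)
  with r(1) show thesis by (rule that)
qed

text \<open>Each piece is a finite Boolean combination of the conditions that some code lies in \<open>r\<close>.\<close>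

lemma definable_pullback_partition:
  assumes "finite P"
    and r: "\<And>r. r \<in> P \<Longrightarrow> definable L' C' m (\<lambda>N b. \<exists>z\<in>codes m N b. (\<alpha> N, z) \<in> r)"
  shows "definable_partition L' C' m (pullback_partition m P)"
proof -
  interpret D': relation_system L' C' "definable L' C'"
    using struct_C' by (rule definable_relation_system)
  have "definable L' C' m (\<lambda>N b. touched m P (N, b) = \<tau>)" if \<tau>: "\<tau> \<subseteq> P" for \<tau>
  proof -
    have "definable L' C' m (\<lambda>N b. r \<in> \<tau> \<longleftrightarrow> (\<exists>z\<in>codes m N b. (\<alpha> N, z) \<in> r))" if "r \<in> P" for r
      using r[OF that] D'.neg[OF r[OF that]] by (cases "r \<in> \<tau>") simp_all
    then have "definable L' C' m (\<lambda>N b. \<forall>r\<in>P. r \<in> \<tau> \<longleftrightarrow> (\<exists>z\<in>codes m N b. (\<alpha> N, z) \<in> r))"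
      using \<open>finite P\<close> by (intro D'.ball)
    then show ?thesis
      by (rule D'.cong) (use \<tau> in \<open>auto simp: touched_def\<close>)
  qed
  then have "definable L' C' m (\<lambda>N b. (N, b) \<in> {x \<in> pointed C' m. touched m P x = touched m P y})" for y
    by (rule D'.cong) (auto simp: touched_def pointed_def)
  then show ?thesis
    by (auto simp: definable_partition_iff pullback_partition_def)
qed

text \<open>It suffices to estimate sizes on the pairs \<open>(N, b)\<close> that have a code in a given piece \<open>r\<close>: every
  piece of the pulled back partition consists of such pairs, for some \<open>r\<close>.\<close>

lemma pull_back_sizes:
  assumes P: "finite P" "partition_on (pointed C (m * d + p)) P"
    and strong: "\<And>r. strong \<Longrightarrow> r \<in> P \<Longrightarrow> definable L' C' m (\<lambda>N b. \<exists>z\<in>codes m N b. (\<alpha> N, z) \<in> r)"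
    and s: "\<And>r. r \<in> P \<Longrightarrow> s r \<in> S"
    and close: "\<And>r r'. r \<in> P \<Longrightarrow> (\<And>N b. (N, b) \<in> r' \<Longrightarrow> (N, b) \<in> pointed C' m \<and> (\<exists>z\<in>codes m N b. (\<alpha> N, z) \<in> r)) \<Longrightarrow>
      size_close T Q \<phi> n r' (s r \<circ> \<alpha>)"
  shows "\<exists>P' s'. finite P' \<and> partition_on (pointed C' m) P' \<and>
    (strong \<longrightarrow> definable_partition L' C' m P') \<and>
    (\<forall>r'\<in>P'. s' r' \<in> pullback \<alpha> S \<and> size_close T Q \<phi> n r' (s' r'))"
proof -
  let ?P' = "pullback_partition m P"
  have "\<forall>r'\<in>?P'. \<exists>s'. s' \<in> pullback \<alpha> S \<and> size_close T Q \<phi> n r' s'"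
  proof
    fix r' assume "r' \<in> ?P'"
    with P(2) obtain r where r: "r \<in> P"
      "\<And>N b. (N, b) \<in> r' \<Longrightarrow> (N, b) \<in> pointed C' m \<and> (\<exists>z\<in>codes m N b. (\<alpha> N, z) \<in> r)"
      by (rule pullback_partition_code) blast
    then show "\<exists>s'. s' \<in> pullback \<alpha> S \<and> size_close T Q \<phi> n r' s'"
      using close[OF r] s[OF r(1)] by (auto simp: pullback_def)
  qed
  from bchoice[OF this] obtain s' where "\<forall>r'\<in>?P'. s' r' \<in> pullback \<alpha> S \<and> size_close T Q \<phi> n r' (s' r')"
    by (rule exE)
  moreover have "strong \<longrightarrow> definable_partition L' C' m ?P'"
    by (intro impI definable_pullback_partition P(1)) (rule strong)
  ultimately show ?thesis
    using finite_pullback_partition[OF P(1)] partition_on_pullback_partition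
    by (intro exI[of _ ?P'] exI[of _ s'] conjI)
qed

lemma large_image:
  assumes "N \<in> C'" "K * (K ^ d + 1) \<le> card (univ N)"
  shows "K \<le> card (univ (\<alpha> N))"
proof (rule ccontr)
  assume "\<not> K \<le> card (univ (\<alpha> N))"
  then have K: "card (univ (\<alpha> N)) < K" by simp
  have "card (univ N) \<le> card (univ (\<alpha> N)) ^ d" using assms(1) by (rule card_univ_le)
  also have "\<dots> \<le> K ^ d" using K by (simp add: power_mono)
  also have "\<dots> < K * (K ^ d + 1)" using K by (cases K) simp_all
  finally show False using assms(2) by simp
qed

theorem transfer_definable:
  assumes prec: "precision T Q" and sized: "sized_class T Q False L R C"
    and Id: "\<And>N. N \<in> C' \<Longrightarrow> ieq I (\<alpha> N) (c N) = Id_on (dm N)"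
  shows "sized_class T Q False L' (pullback \<alpha> R) C'"
  unfolding sized_class_def
proof (intro allI ballI)
  fix n m \<phi> assume "\<phi> \<in> formulas L' (n + m)"
  then obtain \<phi>' E where formulas: "counting_formulas n m \<phi> \<phi>' E"
    using ex_counting_formulas by blast
  note \<phi>' = counting_formulasD(1)[OF formulas]
  note count = counting_formulasD(3)[OF formulas] counting_formulasD(4)[OF formulas] counting_formulasD(5)[OF formulas]
  obtain P s where P: "finite P" "partition_on (pointed C (m * d + p)) P"
    and s: "\<forall>r\<in>P. s r \<in> R \<and> size_close T Q \<phi>' (n * d) r (s r)"
    by (rule sized_classE[OF sized \<phi>']) blast
  show "\<exists>P s. finite P \<and> partition_on (pointed C' m) P \<and> (False \<longrightarrow> definable_partition L' C' m P) \<and>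
      (\<forall>r\<in>P. s r \<in> pullback \<alpha> R \<and> size_close T Q \<phi> n r (s r))"
  proof (rule pull_back_sizes[OF P])
    fix r r' assume r: "r \<in> P"
      and r': "\<And>N b. (N, b) \<in> r' \<Longrightarrow> (N, b) \<in> pointed C' m \<and> (\<exists>z\<in>codes m N b. (\<alpha> N, z) \<in> r)"
    show "size_close T Q \<phi> n r' (s r \<circ> \<alpha>)"
      unfolding size_close_def
    proof
      fix \<epsilon> assume "\<epsilon> \<in> T"
      then obtain K where K: "K \<in> Q"
        "\<forall>(M, z)\<in>r. K \<le> card (univ M) \<longrightarrow> \<bar>real (card (def_set M \<phi>' (n * d) z)) - s r M\<bar> \<le> \<epsilon> * s r M"
        using s r unfolding size_close_def by blast
      have "\<forall>(N, b)\<in>r'. K * (K ^ d + 1) \<le> card (univ N) \<longrightarrow>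
          \<bar>real (card (def_set N \<phi> n b)) - (s r \<circ> \<alpha>) N\<bar> \<le> \<epsilon> * (s r \<circ> \<alpha>) N"
      proof (clarify)
        fix N b assume Nb: "(N, b) \<in> r'" and large: "K * (K ^ d + 1) \<le> card (univ N)"
        from r'[OF Nb] have N: "N \<in> C'" and b: "b \<in> nlists m (univ N)" by (auto simp: pointed_def)
        from r'[OF Nb] obtain bs where bs: "bs \<in> nlists m (dm N)" "map (h N) b = map (cls N) bs"
          "(\<alpha> N, concat bs @ c N) \<in> r" by (auto simp: codes_def)
        show "\<bar>real (card (def_set N \<phi> n b)) - (s r \<circ> \<alpha>) N\<bar> \<le> \<epsilon> * (s r \<circ> \<alpha>) N"
          using count(3)[OF N b bs(1,2) Id[OF N]] bspec[OF K(2) bs(3)] large_image[OF N large] by simp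
      qed
      moreover have "K * (K ^ d + 1) \<in> Q" using prec K(1) by (simp add: precision_def)
      ultimately show "\<exists>K\<in>Q. \<forall>(N, b)\<in>r'. K \<le> card (univ N) \<longrightarrow>
          \<bar>real (card (def_set N \<phi> n b)) - (s r \<circ> \<alpha>) N\<bar> \<le> \<epsilon> * (s r \<circ> \<alpha>) N" by blast
    qed
  qed (use s in auto)
qed

text \<open>Here the definability of the pieces enters: the condition that \<open>(x, c)\<close> lies in \<open>q\<close> becomes part
  of the formula.\<close>

lemma restrict_to_piece:
  assumes \<phi>': "\<phi>' \<in> formulas L (n * d + (m * d + p))"
    and q: "definable L C (n * d + p) (\<lambda>M x. (M, x) \<in> q)"
  obtains \<phi>q where "\<phi>q \<in> formulas L (n * d + (m * d + p))"
    and "\<And>M y w. M \<in> C \<Longrightarrow> y \<in> nlists (m * d) (univ M) \<Longrightarrow> w \<in> nlists p (univ M) \<Longrightarrow>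
      def_set M \<phi>q (n * d) (y @ w) = {x \<in> def_set M \<phi>' (n * d) (y @ w). (M, x @ w) \<in> q}"
proof -
  let ?k = "n * d + (m * d + p)"
  let ?x = "[0..<0 + n * d]" and ?w = "[n * d + m * d..<n * d + m * d + p]"
  have "?x @ ?w \<in> nlists (n * d + p) {..<?k}"
    by (intro nlists_appendI segment_in_nlists; simp)
  then have "definable L C ?k (\<lambda>M zs. holds M \<phi>' zs \<and> (M, map ((!) zs) (?x @ ?w)) \<in> q)"
    by (intro defin.conj defin.holds_formula[OF \<phi>'] defin_subst[OF q])
  then obtain \<phi>q where \<phi>q: "\<phi>q \<in> formulas L ?k"
    and iff: "\<And>M zs. M \<in> C \<Longrightarrow> zs \<in> nlists ?k (univ M) \<Longrightarrow>
      holds M \<phi>q zs \<longleftrightarrow> holds M \<phi>' zs \<and> (M, map ((!) zs) (?x @ ?w)) \<in> q"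
    unfolding definable_def by blast
  show thesis
  proof (rule that[OF \<phi>q])
    fix M y w
    assume M: "M \<in> C" and y: "y \<in> nlists (m * d) (univ M)" and w: "w \<in> nlists p (univ M)"
    have "holds M \<phi>q (x @ y @ w) \<longleftrightarrow> holds M \<phi>' (x @ y @ w) \<and> (M, x @ w) \<in> q"
      if x: "x \<in> nlists (n * d) (univ M)" for x
    proof -
      have "x @ y @ w \<in> nlists ?k (univ M)" by (intro nlists_appendI x y w)
      moreover have "map ((!) (x @ y @ w)) ?x = x" "map ((!) (x @ y @ w)) ?w = w"
        using nlistsE_length[OF x] nlistsE_length[OF y] nlistsE_length[OF w]
        by (subst map_nth_segment; simp)+
      ultimately show ?thesis using iff[OF M] by simp
    qed
    then show "def_set M \<phi>q (n * d) (y @ w) = {x \<in> def_set M \<phi>' (n * d) (y @ w). (M, x @ w) \<in> q}"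
      by (auto simp: def_set_def)
  qed
qed

text \<open>The sum of the reciprocals of the class sizes is split according to the piece \<open>q\<close> of \<open>PE\<close> that
  contains \<open>(x, c)\<close>. On \<open>q\<close> the class sizes are close to \<open>e q\<close>, and the number of summands is close to
  \<open>g r q\<close>, where \<open>r\<close> is the piece of a code of \<open>b\<close>; the partition \<open>P\<close> is common to all \<open>q\<close>.\<close>

theorem transfer_Frac:
  assumes prec: "precision T Q" and sized: "sized_class T Q True L R C"
    and strong: "\<And>m r. strong \<Longrightarrow> definable L C (m * d + p) (\<lambda>M z. (M, z) \<in> r) \<Longrightarrow>
      definable L' C' m (\<lambda>N b. \<exists>z\<in>codes m N b. (\<alpha> N, z) \<in> r)"
  shows "sized_class T Q strong L' (pullback \<alpha> (Frac R)) C'"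
  unfolding sized_class_def
proof (intro allI ballI)
  fix n m \<phi> assume "\<phi> \<in> formulas L' (n + m)"
  then obtain \<phi>' E where formulas: "counting_formulas n m \<phi> \<phi>' E"
    using ex_counting_formulas by blast
  note \<phi>' = counting_formulasD(1)[OF formulas] and E = counting_formulasD(2)[OF formulas]
  note count = counting_formulasD(3)[OF formulas] counting_formulasD(4)[OF formulas] counting_formulasD(5)[OF formulas]
  obtain PE e where PE: "finite PE" "partition_on (pointed C (n * d + p)) PE"
      "definable_partition L C (n * d + p) PE"
    and e: "\<And>q. q \<in> PE \<Longrightarrow> e q \<in> R \<and> size_close T Q E (n * d) q (e q)"
    by (rule sized_classE[OF sized E]) blast
  have "\<forall>q\<in>PE. \<exists>\<psi>. \<psi> \<in> formulas L (n * d + (m * d + p)) \<and>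
      (\<forall>M\<in>C. \<forall>y\<in>nlists (m * d) (univ M). \<forall>w\<in>nlists p (univ M).
        def_set M \<psi> (n * d) (y @ w) = {x \<in> def_set M \<phi>' (n * d) (y @ w). (M, x @ w) \<in> q})"
  proof
    fix q assume "q \<in> PE"
    with PE(3) have "definable L C (n * d + p) (\<lambda>M x. (M, x) \<in> q)"
      by (simp add: definable_partition_iff)
    with \<phi>' show "\<exists>\<psi>. \<psi> \<in> formulas L (n * d + (m * d + p)) \<and>
      (\<forall>M\<in>C. \<forall>y\<in>nlists (m * d) (univ M). \<forall>w\<in>nlists p (univ M).
        def_set M \<psi> (n * d) (y @ w) = {x \<in> def_set M \<phi>' (n * d) (y @ w). (M, x @ w) \<in> q})"
      by (rule restrict_to_piece) blast
  qed
  from bchoice[OF this] obtain \<psi> where "\<forall>q\<in>PE. \<psi> q \<in> formulas L (n * d + (m * d + p)) \<and>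
      (\<forall>M\<in>C. \<forall>y\<in>nlists (m * d) (univ M). \<forall>w\<in>nlists p (univ M).
        def_set M (\<psi> q) (n * d) (y @ w) = {x \<in> def_set M \<phi>' (n * d) (y @ w). (M, x @ w) \<in> q})"
    by (rule exE)
  then have \<psi>: "\<And>q. q \<in> PE \<Longrightarrow> \<psi> q \<in> formulas L (n * d + (m * d + p))"
    and \<psi>_set: "\<And>q M y w. q \<in> PE \<Longrightarrow> M \<in> C \<Longrightarrow> y \<in> nlists (m * d) (univ M) \<Longrightarrow> w \<in> nlists p (univ M) \<Longrightarrow>
      def_set M (\<psi> q) (n * d) (y @ w) = {x \<in> def_set M \<phi>' (n * d) (y @ w). (M, x @ w) \<in> q}"
    by simp_all
  have "\<exists>P s. finite P \<and> partition_on (pointed C (m * d + p)) P \<and>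
      (True \<longrightarrow> definable_partition L C (m * d + p) P) \<and>
      (\<forall>r\<in>P. \<forall>q\<in>PE. s r q \<in> R \<and> size_close T Q (\<psi> q) (n * d) r (s r q))"
    using struct_C sized PE(1) \<psi> by (rule sized_class_common_partition)
  then obtain P g where P: "finite P" "partition_on (pointed C (m * d + p)) P"
      "True \<longrightarrow> definable_partition L C (m * d + p) P"
    and "\<forall>r\<in>P. \<forall>q\<in>PE. g r q \<in> R \<and> size_close T Q (\<psi> q) (n * d) r (g r q)"
    by (elim exE conjE)
  then have g: "g r q \<in> R \<and> size_close T Q (\<psi> q) (n * d) r (g r q)" if "r \<in> P" "q \<in> PE" for r q
    using that by simp
  define s where "s r M = (\<Sum>q\<in>PE. g r q M / e q M)" for r M
  show "\<exists>P s. finite P \<and> partition_on (pointed C' m) P \<and> (strong \<longrightarrow> definable_partition L' C' m P) \<and>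
      (\<forall>r\<in>P. s r \<in> pullback \<alpha> (Frac R) \<and> size_close T Q \<phi> n r (s r))"
  proof (rule pull_back_sizes[OF P(1,2)])
    show "definable L' C' m (\<lambda>N b. \<exists>z\<in>codes m N b. (\<alpha> N, z) \<in> r)" if strong "r \<in> P" for r
      using strong[OF \<open>strong\<close>] P(3) \<open>r \<in> P\<close> by (simp add: definable_partition_iff)
    show "s r \<in> Frac R" if r: "r \<in> P" for r
    proof -
      \<comment> \<open>A sum in \<open>Frac R\<close> has at least one term, so \<open>PE\<close> has to be nonempty.\<close>
      have "r \<noteq> {}" using partition_onD3[OF P(2)] r by auto
      then obtain M z where "(M, z) \<in> r" by auto
      then have "M \<in> C" using partition_onD1[OF P(2)] r by (auto simp: pointed_def)
      then have "\<exists>z. z \<in> nlists (n * d + p) (univ M)"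
        using struct_C by (intro nlists_not_empty) (simp add: is_struct_def)
      then have "PE \<noteq> {}" using partition_onD1[OF PE(2)] \<open>M \<in> C\<close> by (auto simp: pointed_def)
      then have "(\<lambda>M. \<Sum>q\<in>PE. g r q M / e q M) \<in> Frac R"
        using PE(1) g[OF r] e by (intro Frac_sum) auto
      then show ?thesis by (simp add: s_def[abs_def])
    qed
    fix r r' assume r: "r \<in> P"
      and r': "\<And>N b. (N, b) \<in> r' \<Longrightarrow> (N, b) \<in> pointed C' m \<and> (\<exists>z\<in>codes m N b. (\<alpha> N, z) \<in> r)"
    show "size_close T Q \<phi> n r' (s r \<circ> \<alpha>)"
      unfolding size_close_def
    proof
      fix \<epsilon> assume "\<epsilon> \<in> T"
      define \<delta> where "\<delta> = \<epsilon> / (2 + \<epsilon>)"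
      have "0 \<le> \<epsilon>" "\<delta> \<in> T" using prec \<open>\<epsilon> \<in> T\<close> by (auto simp: precision_def \<delta>_def)
      have "\<exists>K\<in>Q. \<forall>q\<in>PE. \<forall>k\<ge>K.
          (\<forall>(M, y)\<in>q. card (univ M) = k \<longrightarrow> \<bar>real (card (def_set M E (n * d) y)) - e q M\<bar> \<le> \<delta> * e q M)"
      proof (rule common_threshold[OF prec PE(1)])
        fix q assume "q \<in> PE"
        then obtain K where "K \<in> Q"
          "\<forall>(M, y)\<in>q. K \<le> card (univ M) \<longrightarrow> \<bar>real (card (def_set M E (n * d) y)) - e q M\<bar> \<le> \<delta> * e q M"
          using e \<open>\<delta> \<in> T\<close> unfolding size_close_def by blast
        then show "\<exists>K\<in>Q. \<forall>k\<ge>K. \<forall>(M, y)\<in>q. card (univ M) = k \<longrightarrow>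
            \<bar>real (card (def_set M E (n * d) y)) - e q M\<bar> \<le> \<delta> * e q M"
          by (intro bexI[of _ K]) auto
      qed
      then obtain K1 where K1: "K1 \<in> Q" "\<forall>q\<in>PE. \<forall>k\<ge>K1.
          (\<forall>(M, y)\<in>q. card (univ M) = k \<longrightarrow> \<bar>real (card (def_set M E (n * d) y)) - e q M\<bar> \<le> \<delta> * e q M)"
        by (rule bexE)
      have e_close: "\<bar>real (card (def_set M E (n * d) y)) - e q M\<bar> \<le> \<delta> * e q M"
        if "q \<in> PE" "(M, y) \<in> q" "K1 \<le> card (univ M)" for q M y
        using K1(2)[THEN bspec, OF that(1), THEN spec, THEN mp, OF that(3)] that(2) by auto
      have "\<exists>K\<in>Q. \<forall>q\<in>PE. \<forall>k\<ge>K.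
          (\<forall>(M, z)\<in>r. card (univ M) = k \<longrightarrow> \<bar>real (card (def_set M (\<psi> q) (n * d) z)) - g r q M\<bar> \<le> \<delta> * g r q M)"
      proof (rule common_threshold[OF prec PE(1)])
        fix q assume "q \<in> PE"
        then obtain K where "K \<in> Q"
          "\<forall>(M, z)\<in>r. K \<le> card (univ M) \<longrightarrow> \<bar>real (card (def_set M (\<psi> q) (n * d) z)) - g r q M\<bar> \<le> \<delta> * g r q M"
          using g[OF r] \<open>\<delta> \<in> T\<close> unfolding size_close_def by blast
        then show "\<exists>K\<in>Q. \<forall>k\<ge>K. \<forall>(M, z)\<in>r. card (univ M) = k \<longrightarrow>
            \<bar>real (card (def_set M (\<psi> q) (n * d) z)) - g r q M\<bar> \<le> \<delta> * g r q M"
          by (intro bexI[of _ K]) auto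
      qed
      then obtain K2 where K2: "K2 \<in> Q" "\<forall>q\<in>PE. \<forall>k\<ge>K2.
          (\<forall>(M, z)\<in>r. card (univ M) = k \<longrightarrow> \<bar>real (card (def_set M (\<psi> q) (n * d) z)) - g r q M\<bar> \<le> \<delta> * g r q M)"
        by (rule bexE)
      have g_close: "\<bar>real (card (def_set M (\<psi> q) (n * d) z)) - g r q M\<bar> \<le> \<delta> * g r q M"
        if "q \<in> PE" "(M, z) \<in> r" "K2 \<le> card (univ M)" for q M z
        using K2(2)[THEN bspec, OF that(1), THEN spec, THEN mp, OF that(3)] that(2) by auto
      define K where "K = max K1 K2"
      have "\<bar>real (card (def_set N \<phi> n b)) - (s r \<circ> \<alpha>) N\<bar> \<le> \<epsilon> * (s r \<circ> \<alpha>) N"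
        if Nb: "(N, b) \<in> r'" and large: "K * (K ^ d + 1) \<le> card (univ N)" for N b
      proof -
        from r'[OF Nb] have N: "N \<in> C'" and b: "b \<in> nlists m (univ N)" by (auto simp: pointed_def)
        from r'[OF Nb] obtain bs where bs: "bs \<in> nlists m (dm N)" "map (h N) b = map (cls N) bs"
          "(\<alpha> N, concat bs @ c N) \<in> r" by (auto simp: codes_def)
        let ?M = "\<alpha> N"
        have M: "?M \<in> C" "finite (univ ?M)" using \<alpha>_in[OF N] finite_C by (auto simp: finite_class_def)
        from large_image[OF N large] have K: "K1 \<le> card (univ ?M)" "K2 \<le> card (univ ?M)"
          by (simp_all add: K_def)
        let ?D = "def_set ?M \<phi>' (n * d) (concat bs @ c N)"
        let ?Dq = "\<lambda>q. {x \<in> ?D. (?M, x @ c N) \<in> q}"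
        let ?e = "\<lambda>x. real (card (def_set ?M E (n * d) (x @ c N)))"
        have finite_def_set: "finite (def_set ?M \<theta> k y)" for \<theta> k y
          using finite_nlists[OF M(2)] by (simp add: def_set_def)
        have e_pos: "0 < ?e x" if "x \<in> ?D" for x
          using count(2)[OF N b bs(1,2)] that finite_def_set by (auto simp: card_gt_0_iff)
        have "\<forall>x\<in>?D. \<exists>q. q \<in> PE \<and> (?M, x @ c N) \<in> q"
        proof
          fix x assume "x \<in> ?D"
          then have "x @ c N \<in> nlists (n * d + p) (univ ?M)"
            by (intro nlists_appendI par_in[OF N]) (simp add: def_set_def)
          then have "(?M, x @ c N) \<in> \<Union> PE"
            unfolding partition_onD1[OF PE(2), symmetric] using M(1) by (simp add: pointed_def)
          then show "\<exists>q. q \<in> PE \<and> (?M, x @ c N) \<in> q" by blast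
        qed
        from bchoice[OF this] obtain \<kappa> where \<kappa>: "\<forall>x\<in>?D. \<kappa> x \<in> PE \<and> (?M, x @ c N) \<in> \<kappa> x"
          by (rule exE)
        have Dq: "{x \<in> ?D. \<kappa> x = q} = ?Dq q" if "q \<in> PE" for q
          using \<kappa> that partition_onD2[OF PE(2)] by (auto dest: disjointD)
        have "real (card (def_set N \<phi> n b)) = (\<Sum>x\<in>?D. 1 / ?e x)"
          using N b bs(1,2) by (rule count(1))
        also have "\<dots> = (\<Sum>q\<in>PE. \<Sum>x\<in>{x \<in> ?D. \<kappa> x = q}. 1 / ?e x)"
          by (rule sum.group[symmetric, OF finite_def_set PE(1)]) (use \<kappa> in auto)
        also have "\<dots> = (\<Sum>q\<in>PE. \<Sum>x\<in>?Dq q. 1 / ?e x)"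
          by (rule sum.cong) (simp_all add: Dq)
        finally have card_eq: "real (card (def_set N \<phi> n b)) = (\<Sum>q\<in>PE. \<Sum>x\<in>?Dq q. 1 / ?e x)" .
        have piece: "\<bar>(\<Sum>x\<in>?Dq q. 1 / ?e x) - g r q ?M / e q ?M\<bar> \<le> \<epsilon> * (g r q ?M / e q ?M)"
          if q: "q \<in> PE" for q
        proof (rule sum_reciprocals_close[OF \<open>0 \<le> \<epsilon>\<close>])
          show "finite (?Dq q)" using finite_def_set by simp
          show "0 < ?e x \<and> \<bar>?e x - e q ?M\<bar> \<le> \<epsilon> / (2 + \<epsilon>) * e q ?M" if "x \<in> ?Dq q" for x
            using that e_pos e_close[OF q _ K(1), of "x @ c N"] by (simp add: \<delta>_def)
          show "\<bar>real (card (?Dq q)) - g r q ?M\<bar> \<le> \<epsilon> / (2 + \<epsilon>) * g r q ?M"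
            using g_close[OF q bs(3) K(2)] \<psi>_set[OF q M(1) concat_dom_in[OF bs(1)] par_in[OF N]]
            by (simp add: \<delta>_def)
        qed
        have "real (card (def_set N \<phi> n b)) - s r ?M
            = (\<Sum>q\<in>PE. (\<Sum>x\<in>?Dq q. 1 / ?e x) - g r q ?M / e q ?M)"
          unfolding card_eq s_def by (simp add: sum_subtractf)
        also have "\<bar>\<dots>\<bar> \<le> (\<Sum>q\<in>PE. \<epsilon> * (g r q ?M / e q ?M))"
          by (rule order_trans[OF sum_abs sum_mono[OF piece]])
        also have "\<dots> = \<epsilon> * s r ?M"
          by (simp only: s_def sum_distrib_left)
        finally show ?thesis by simp
      qed
      moreover have "K * (K ^ d + 1) \<in> Q"
        using prec K1(1) K2(1) by (simp add: precision_def K_def)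
      ultimately show "\<exists>K\<in>Q. \<forall>(N, b)\<in>r'. K \<le> card (univ N) \<longrightarrow>
          \<bar>real (card (def_set N \<phi> n b)) - (s r \<circ> \<alpha>) N\<bar> \<le> \<epsilon> * (s r \<circ> \<alpha>) N" by blast
    qed
  qed
qed

end

section \<open>Weak bi-interpretations\<close>

text \<open>Let \<open>N\<close> interpret \<open>M = \<alpha> N\<close> through \<open>J\<close>, via \<open>g\<close>. A code of \<open>b\<close> is a tuple from \<open>M\<close>, so it is in turn
  represented by a tuple of elements of \<open>N\<close>, of which \<open>\<psi>'\<close> says that the code lies in \<open>r\<close>. That a
  tuple \<open>cs\<close> from \<open>N\<close> represents some member of the class of \<open>b\<^sub>k\<close> means that the classes of its entries
  form an element of \<open>induced_iso g (f b\<^sub>k)\<close>, which is what \<open>\<chi>(b\<^sub>k, cs)\<close> states.\<close>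

lemma codes_definable:
  fixes C :: "('a, 'f, 'r) struct set" and C' :: "('b, 'g, 's) struct set"
  assumes A: "uniform_interpretation L' C' L C \<alpha> I (\<lambda>_. []) f"
    and B: "uniform_interpretation L C L' C' \<beta> J (\<lambda>_. []) (\<lambda>M. g (\<beta> M))"
    and inv: "\<And>N. N \<in> C' \<Longrightarrow> \<beta> (\<alpha> N) = N"
    and npar: "npar I = 0" "npar J = 0"
    and \<chi>: "\<chi> \<in> formulas L' (1 + idim I * idim J)"
    and def_map: "\<And>N. N \<in> C' \<Longrightarrow> defines_map I J N \<chi> (induced_iso (g N) \<circ> f N)"
    and r: "definable L C (m * idim I + npar I) (\<lambda>M z. (M, z) \<in> r)"
  shows "definable L' C' m (\<lambda>N b. \<exists>z\<in>uniform_interpretation.codes \<alpha> I (\<lambda>_. []) f m N b. (\<alpha> N, z) \<in> r)"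
proof -
  interpret A: uniform_interpretation L' C' L C \<alpha> I "\<lambda>_. []" f by (rule A)
  interpret B: uniform_interpretation L C L' C' \<beta> J "\<lambda>_. []" "\<lambda>M. g (\<beta> M)" by (rule B)
  let ?d = "idim I" and ?e = "idim J"
  let ?l = "?d * ?e"
  obtain \<psi> where \<psi>: "\<psi> \<in> formulas L (m * ?d)"
    and \<psi>_iff: "\<And>M z. M \<in> C \<Longrightarrow> z \<in> nlists (m * ?d) (univ M) \<Longrightarrow> holds M \<psi> z \<longleftrightarrow> (M, z) \<in> r"
    using r unfolding definable_def npar by auto
  obtain \<psi>' where \<psi>'': "\<psi>' \<in> formulas L' (m * ?d * ?e + npar J)"
    and \<psi>'_iff: "\<And>M zs cs. M \<in> C \<Longrightarrow> zs \<in> nlists (m * ?d) (univ M) \<Longrightarrow>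
      cs \<in> nlists (m * ?d) (B.dm M) \<Longrightarrow> map (g (\<beta> M)) zs = map (B.cls M) cs \<Longrightarrow>
      holds M \<psi> zs \<longleftrightarrow> holds (\<beta> M) \<psi>' (concat cs @ [])"
    using \<psi> by (rule B.translation) blast
  have \<psi>': "\<psi>' \<in> formulas L' (m * ?l)" using \<psi>'' by (simp add: npar mult.assoc)
  \<comment> \<open>In \<open>b @ ys\<close> these are the positions of \<open>b\<^sub>k\<close> and of the \<open>k\<close>-th block of \<open>ys\<close>, which is to
    represent a member of the class of \<open>b\<^sub>k\<close>.\<close>
  let ?u = "\<lambda>k. [k..<k + 1] @ [m + k * ?l..<m + k * ?l + ?l]"
  let ?X = "\<lambda>N b. \<exists>ys\<in>nlists (m * ?l) (univ N).
    (\<forall>k\<in>{..<m}. holds N \<chi> (map ((!) (b @ ys)) (?u k))) \<and>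
    holds N \<psi>' (map ((!) (b @ ys)) [m..<m + m * ?l])"
  have bound: "k * ?l + ?l \<le> m * ?l" if "k < m" for k
    using mult_le_mono1[of "Suc k" m ?l] that by simp
  have "definable L' C' m ?X"
  proof (intro B.defin.ex[where X = "\<lambda>N zs. (\<forall>k\<in>{..<m}. holds N \<chi> (map ((!) zs) (?u k))) \<and>
      holds N \<psi>' (map ((!) zs) [m..<m + m * ?l])"] B.defin.conj B.defin.ball B.defin_subst B.defin.holds_formula)
    show "?u k \<in> nlists (1 + ?l) {..<m + m * ?l}" if "k \<in> {..<m}" for k
      using bound[of k] that by (intro nlists_appendI segment_in_nlists) auto
    show "[m..<m + m * ?l] \<in> nlists (m * ?l) {..<m + m * ?l}"
      by (rule segment_in_nlists) simp
  qed (use \<chi> \<psi>' in simp_all)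
  then show ?thesis
  proof (rule B.defin.cong)
    fix N b assume N: "N \<in> C'" and b: "b \<in> nlists m (univ N)"
    let ?M = "\<alpha> N" and ?U = "univ N"
    let ?dm = "idom J N []" and ?cls = "icls J N []"
    have M: "?M \<in> C" "\<beta> ?M = N" using A.\<alpha>_in inv N by auto
    have bk: "b ! k \<in> ?U" if "k < m" for k using nlistsE_nth_in[OF b that] .
    have seg: "map ((!) (b @ concat yss)) (?u k) = b ! k # yss ! k"
      if yss: "yss \<in> nlists m (nlists ?l ?U)" and k: "k < m" for yss k
    proof -
      have len: "length b = m" "length (concat yss) = m * ?l"
        using nlistsE_length[OF b] length_concat_nlists[OF yss] by auto
      have "map ((!) (b @ concat yss)) [m + k * ?l..<m + k * ?l + ?l] = yss ! k"
        using bound[OF k] concat_segment[OF yss k, of "[]"] len by (subst map_nth_segment) auto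
      then show ?thesis
        using len k by (simp add: nth_append)
    qed
    have seg': "map ((!) (b @ concat yss)) [m..<m + m * ?l] = concat yss"
      if yss: "yss \<in> nlists m (nlists ?l ?U)" for yss
      using nlistsE_length[OF b] length_concat_nlists[OF yss] by (subst map_nth_segment) simp_all
    have \<chi>_iff: "holds N \<chi> (b ! k # concat cs) \<longleftrightarrow>
        set cs \<subseteq> ?dm \<and> (\<exists>w\<in>f N (b ! k). map ?cls cs = map (g N) w)"
      if "k < m" "cs \<in> nlists ?d (nlists ?e ?U)" for k cs
      using def_map[OF N] bk[OF that(1)] that(2) by (auto simp: defines_map_def induced_iso_def)
    show "?X N b \<longleftrightarrow> (\<exists>z\<in>A.codes m N b. (?M, z) \<in> r)"
    proof
      assume "?X N b"
      then obtain ys where ys: "ys \<in> nlists (m * ?l) ?U"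
        "\<forall>k\<in>{..<m}. holds N \<chi> (map ((!) (b @ ys)) (?u k))"
        "holds N \<psi>' (map ((!) (b @ ys)) [m..<m + m * ?l])" by blast
      from ys(1) obtain yss where yss: "yss \<in> nlists m (nlists ?l ?U)" and ys_eq: "ys = concat yss"
        by (rule nlists_concat_cases)
      have "\<forall>k\<in>{..<m}. \<exists>x. fst x \<in> nlists ?d ?dm \<and> yss ! k = concat (fst x) \<and>
          snd x \<in> f N (b ! k) \<and> map ?cls (fst x) = map (g N) (snd x)"
      proof
        fix k assume "k \<in> {..<m}"
        then have k: "k < m" by simp
        obtain cs where cs: "cs \<in> nlists ?d (nlists ?e ?U)" "yss ! k = concat cs"
          using nlistsE_nth_in[OF yss k] by (rule nlists_concat_cases)
        have "holds N \<chi> (map ((!) (b @ concat yss)) (?u k))"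
          using ys(2) k unfolding ys_eq by blast
        then have "holds N \<chi> (b ! k # concat cs)"
          unfolding seg[OF yss k] cs(2) .
        then obtain w where w: "set cs \<subseteq> ?dm" "w \<in> f N (b ! k)" "map ?cls cs = map (g N) w"
          using \<chi>_iff[OF k cs(1)] by blast
        moreover have "cs \<in> nlists ?d ?dm" using nlistsE_length[OF cs(1)] w(1) by (rule nlistsI)
        ultimately show "\<exists>x. fst x \<in> nlists ?d ?dm \<and> yss ! k = concat (fst x) \<and>
            snd x \<in> f N (b ! k) \<and> map ?cls (fst x) = map (g N) (snd x)"
          using cs(2) by (intro exI[of _ "(cs, w)"]) simp
      qed
      \<comment> \<open>\<open>snd (x k)\<close> is a representative of \<open>b\<^sub>k\<close> in \<open>\<alpha> N\<close>, and \<open>fst (x k)\<close> represents it in turn in \<open>N\<close>.\<close>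
      from bchoice[OF this] obtain x where x: "\<forall>k\<in>{..<m}. fst (x k) \<in> nlists ?d ?dm \<and>
          yss ! k = concat (fst (x k)) \<and> snd (x k) \<in> f N (b ! k) \<and>
          map ?cls (fst (x k)) = map (g N) (snd (x k))"
        by (rule exE)
      let ?css = "map (\<lambda>k. fst (x k)) [0..<m]" and ?bs = "map (\<lambda>k. snd (x k)) [0..<m]"
      have bs: "?bs \<in> nlists m (A.dm N)" "map (f N) b = map (A.cls N) ?bs"
        using x A.mem_h_iff[OF N bk] nlistsE_length[OF b]
        by (auto simp: in_nlists_iff_nth list_eq_iff_nth_eq[of "map _ _"])
      have "?css \<in> nlists m (nlists ?d ?dm)" using x by (auto simp: in_nlists_iff_nth)
      then have cs: "concat ?css \<in> nlists (m * ?d) ?dm" by (rule concat_nlists)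
      have "yss = map concat ?css"
        using x nlistsE_length[OF yss] by (auto simp: list_eq_iff_nth_eq)
      then have ys_css: "ys = concat (concat ?css)"
        unfolding ys_eq by (simp only: concat_map_concat)
      have "map (map (g N)) ?bs = map (map ?cls) ?css" using x by auto
      then have "map (g N) (concat ?bs) = map ?cls (concat ?css)" by (simp only: map_concat)
      then have "holds ?M \<psi> (concat ?bs) \<longleftrightarrow> holds N \<psi>' ys"
        using \<psi>'_iff[OF M(1) A.concat_dom_in[OF bs(1)], of "concat ?css"] cs by (simp add: M(2) ys_css)
      moreover have "holds N \<psi>' ys"
        using ys(3) seg'[OF yss] unfolding ys_eq by simp
      ultimately have "(?M, concat ?bs) \<in> r"
        using \<psi>_iff[OF M(1) A.concat_dom_in[OF bs(1)]] by simp
      moreover have "concat ?bs \<in> A.codes m N b"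
        unfolding A.codes_def using bs by (intro CollectI exI[of _ ?bs]) simp
      ultimately show "\<exists>z\<in>A.codes m N b. (?M, z) \<in> r" by blast
    next
      assume "\<exists>z\<in>A.codes m N b. (?M, z) \<in> r"
      then obtain bs where bs: "bs \<in> nlists m (A.dm N)" "map (f N) b = map (A.cls N) bs"
        "(?M, concat bs) \<in> r" unfolding A.codes_def by auto
      note bs_univ = A.concat_dom_in[OF bs(1)]
      obtain cs where cs: "cs \<in> nlists (m * ?d) ?dm" "map (g N) (concat bs) = map ?cls cs"
        using B.obtain_representatives[OF M(1) bs_univ] by (auto simp: M(2))
      from cs(1) obtain css where css: "css \<in> nlists m (nlists ?d ?dm)" "cs = concat css"
        by (rule nlists_concat_cases)
      have dm_sub: "?dm \<subseteq> nlists ?e ?U" using B.dom_subset[of ?M] by (simp add: M(2))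
      \<comment> \<open>Blocks of equal lengths can be recovered from the concatenation.\<close>
      have "map (map (g N)) bs = map (map ?cls) css"
      proof (rule inj_onD[OF inj_on_concat_nlists[of m ?d UNIV]])
        show "concat (map (map (g N)) bs) = concat (map (map ?cls) css)"
          using cs(2) css(2) by (simp only: map_concat)
        show "map (map (g N)) bs \<in> nlists m (nlists ?d UNIV)"
          using subsetD[OF A.nlists_dom_subset bs(1)] by (auto simp: nlists_def)
        show "map (map ?cls) css \<in> nlists m (nlists ?d UNIV)"
          using css(1) by (auto simp: nlists_def)
      qed
      then have nth_eq: "map (g N) (bs ! k) = map ?cls (css ! k)" if "k < m" for k
        using that nlistsE_length[OF bs(1)] nlistsE_length[OF css(1)]
        by (metis nth_map)
      let ?yss = "map concat css"
      have yss: "?yss \<in> nlists m (nlists ?l ?U)"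
      proof (rule nlistsI)
        have "concat w \<in> nlists ?l ?U" if "w \<in> nlists ?d ?dm" for w
          using subsetD[OF nlists_mono[OF dm_sub] that] by (rule concat_nlists)
        then show "set ?yss \<subseteq> nlists ?l ?U" using nlistsE_set[OF css(1)] by auto
      qed (use nlistsE_length[OF css(1)] in simp)
      have "holds N \<chi> (map ((!) (b @ concat ?yss)) (?u k))" if k: "k < m" for k
      proof -
        have c: "css ! k \<in> nlists ?d ?dm" using nlistsE_nth_in[OF css(1) k] .
        have "bs ! k \<in> f N (b ! k)"
          using A.mem_h_iff[OF N bk[OF k]] nlistsE_nth_in[OF bs(1) k]
            arg_cong[OF bs(2), of "\<lambda>xs. xs ! k"] k nlistsE_length[OF b] nlistsE_length[OF bs(1)] by simp
        then have "holds N \<chi> (b ! k # concat (css ! k))"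
          using \<chi>_iff[OF k subsetD[OF nlists_mono[OF dm_sub] c]] nlistsE_set[OF c]
            nth_eq[OF k, symmetric] by blast
        then show ?thesis
          unfolding seg[OF yss k] using k nlistsE_length[OF css(1)] by simp
      qed
      moreover have "holds N \<psi>' (concat ?yss)"
        using \<psi>'_iff[OF M(1) bs_univ, of cs] \<psi>_iff[OF M(1) bs_univ] bs(3) cs
        by (simp add: M(2) css(2) concat_map_concat)
      then have "holds N \<psi>' (map ((!) (b @ concat ?yss)) [m..<m + m * ?l])"
        unfolding seg'[OF yss] .
      ultimately show "?X N b"
        using concat_nlists[OF yss] by (intro bexI[of _ "concat ?yss"]) auto
    qed
  qed
qed

section \<open>The transfer theorem\<close>

lemma param_interpretable_transfer:
  assumes "finite_class L C" "finite_class L' C'" "param_interpretable L' C' L C \<alpha>"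
    and "precision T Q" "sized_class T Q True L R C"
  shows "sized_class T Q False L' (pullback \<alpha> (Frac R)) C'"
proof -
  obtain I where I: "is_scheme L' L I" "\<forall>N\<in>C'. \<exists>x. interpreted_via L' I N (\<alpha> N) (fst x) (snd x)"
    and \<alpha>: "\<alpha> \<in> C' \<rightarrow> C"
    using assms(3) unfolding param_interpretable_def by auto
  from bchoice[OF I(2)] obtain x where "\<forall>N\<in>C'. interpreted_via L' I N (\<alpha> N) (fst (x N)) (snd (x N))"
    by (rule exE)
  then interpret uniform_interpretation L' C' L C \<alpha> I "\<lambda>N. fst (x N)" "\<lambda>N. snd (x N)"
    using assms(1,2) I(1) \<alpha> by unfold_locales simp_all
  show ?thesis
    using assms(4,5) by (rule transfer_Frac) simp
qed

lemma param_definable_transfer: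
  assumes "finite_class L C" "finite_class L' C'" "param_definable L' C' L C \<alpha>"
    and "precision T Q" "sized_class T Q False L R C"
  shows "sized_class T Q False L' (pullback \<alpha> R) C'"
proof -
  obtain I where I: "is_scheme L' L I" "\<forall>N\<in>C'. \<exists>x. interpreted_via L' I N (\<alpha> N) (fst x) (snd x) \<and>
      ieq I (\<alpha> N) (fst x) = Id_on (idom I (\<alpha> N) (fst x))"
    and \<alpha>: "\<alpha> \<in> C' \<rightarrow> C"
    using assms(3) unfolding param_definable_def by auto
  from bchoice[OF I(2)] obtain x where x: "\<forall>N\<in>C'. interpreted_via L' I N (\<alpha> N) (fst (x N)) (snd (x N)) \<and>
      ieq I (\<alpha> N) (fst (x N)) = Id_on (idom I (\<alpha> N) (fst (x N)))"
    by (rule exE)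
  then interpret uniform_interpretation L' C' L C \<alpha> I "\<lambda>N. fst (x N)" "\<lambda>N. snd (x N)"
    using assms(1,2) I(1) \<alpha> by unfold_locales simp_all
  show ?thesis
    using assms(4,5) by (rule transfer_definable) (use x in simp)
qed

lemma weakly_bi_interpretable_transfer:
  fixes C :: "('a, 'f, 'r) struct set"
  assumes "finite_class L C" "finite_class L' C'" "weakly_bi_interpretable L' C' L C \<alpha>"
    and "precision T Q" "sized_class T Q True L R C"
  shows "sized_class T Q True L' (pullback \<alpha> (Frac R)) C'"
proof -
  obtain I J \<chi> where \<alpha>: "bij_betw \<alpha> C' C" and \<chi>: "\<chi> \<in> formulas L' (1 + idim I * idim J)"
    and schemes: "is_scheme L' L I" "npar I = 0" "is_scheme L L' J" "npar J = 0"
    and maps: "\<forall>N\<in>C'. \<exists>f g. interpreted_via L' I N (\<alpha> N) [] f \<and> interpreted_via L J (\<alpha> N) N [] g \<and>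
      defines_map I J N \<chi> (induced_iso g \<circ> f)"
    using assms(3) unfolding weakly_bi_interpretable_def by blast
  from maps have "\<forall>N\<in>C'. \<exists>x. interpreted_via L' I N (\<alpha> N) [] (fst x) \<and>
      interpreted_via L J (\<alpha> N) N [] (snd x) \<and> defines_map I J N \<chi> (induced_iso (snd x) \<circ> fst x)"
    by simp
  from bchoice[OF this] obtain x where x: "\<forall>N\<in>C'. interpreted_via L' I N (\<alpha> N) [] (fst (x N)) \<and>
      interpreted_via L J (\<alpha> N) N [] (snd (x N)) \<and>
      defines_map I J N \<chi> (induced_iso (snd (x N)) \<circ> fst (x N))"
    by (rule exE)
  let ?f = "\<lambda>N. fst (x N)" and ?g = "\<lambda>N. snd (x N)" and ?\<beta> = "inv_into C' \<alpha>"
  have inv: "?\<beta> (\<alpha> N) = N" if "N \<in> C'" for N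
    using bij_betw_inv_into_left[OF \<alpha> that] .
  have \<beta>: "?\<beta> M \<in> C'" "\<alpha> (?\<beta> M) = M" if "M \<in> C" for M
    using bij_betw_inv_into_right[OF \<alpha> that] bij_betwE[OF bij_betw_inv_into[OF \<alpha>]] that by auto
  have A: "uniform_interpretation L' C' L C \<alpha> I (\<lambda>_. []) ?f"
    using assms(1,2) schemes(1) bij_betwE[OF \<alpha>] x by unfold_locales auto
  have B: "uniform_interpretation L C L' C' ?\<beta> J (\<lambda>_. []) (\<lambda>M. ?g (?\<beta> M))"
  proof
    show "interpreted_via L J M (?\<beta> M) [] (?g (?\<beta> M))" if "M \<in> C" for M
      using x[rule_format, OF \<beta>(1)[OF that]] \<beta>(2)[OF that] by simp
  qed (use assms(1,2) schemes(3) \<beta> in auto)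
  interpret A: uniform_interpretation L' C' L C \<alpha> I "\<lambda>_. []" ?f by (rule A)
  show ?thesis
    using assms(4,5)
  proof (rule A.transfer_Frac)
    fix m and r :: "(('a, 'f, 'r) struct \<times> 'a list) set"
    assume r: "definable L C (m * idim I + npar I) (\<lambda>M z. (M, z) \<in> r)"
    show "definable L' C' m (\<lambda>N b. \<exists>z\<in>A.codes m N b. (\<alpha> N, z) \<in> r)"
    proof (rule codes_definable[OF A B])
      show "defines_map I J N \<chi> (induced_iso (?g N) \<circ> ?f N)" if "N \<in> C'" for N
        using x that by simp
    qed (use inv schemes \<chi> r in simp_all)
  qed
qed

theorem theorem2p5p4:
  fixes L :: "('f, 'r) lang" and L' :: "('g, 's) lang"
    and C :: "('a, 'f, 'r) struct set" and C' :: "('b, 'g, 's) struct set"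
    and R :: "(('a, 'f, 'r) struct \<Rightarrow> real) set"
    and \<alpha> :: "('b, 'g, 's) struct \<Rightarrow> ('a, 'f, 'r) struct"
  assumes "finite_class L C" and "finite_class L' C'" and "R \<subseteq> C \<rightarrow> {0..}"
  shows
    "(param_interpretable L' C' L C \<alpha> \<longrightarrow>
        (mac L R C \<longrightarrow> weak_mac L' (pullback \<alpha> (Frac R)) C') \<and>
        (mec L R C \<longrightarrow> weak_mec L' (pullback \<alpha> (Frac R)) C')) \<and>
     (weakly_bi_interpretable L' C' L C \<alpha> \<longrightarrow>
        (mac L R C \<longrightarrow> mac L' (pullback \<alpha> (Frac R)) C') \<and>
        (mec L R C \<longrightarrow> mec L' (pullback \<alpha> (Frac R)) C')) \<and>
     (param_definable L' C' L C \<alpha> \<longrightarrow>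
        (weak_mac L R C \<longrightarrow> weak_mac L' (pullback \<alpha> R) C') \<and>
        (weak_mec L R C \<longrightarrow> weak_mec L' (pullback \<alpha> R) C'))"
  unfolding sized_class_iffs
  using param_interpretable_transfer[OF assms(1,2)] weakly_bi_interpretable_transfer[OF assms(1,2)]
    param_definable_transfer[OF assms(1,2)] precision_asymp precision_exact
  by blast

end
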